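(* Consider $n$ fermionic modes, an initial quadratic Hamiltonian $H^{(0)}=\sum_{i,j}c^{(0)}_{i,j}a_i^\dagger a_j$ with $c^{(0)}$ Hermitian with eigenvalues $\epsilon^{(0)}_1,\dots,\epsilon^{(0)}_n$, and an initial state $\rho^{(0)}$ whose correlation matrix $\gamma(\rho^{(0)})$ has eigenvalues $d^{(0)}_1,\dots,d^{(0)}_n$. For every cyclic protocol consisting of $N\ge1$ quenches to arbitrary quadratic Hamiltonians $H^{(1)},\dots,H^{(N)}=H^{(0)}$, each followed by equilibration to the generalised Gibbs ensemble (GGE) of normal-mode occupations, the final state $\omega^{(N)}_{\mathrm{GGE}}$ satisfies $$\mathrm{tr}\big(\omega^{(N)}_{\mathrm{GGE}}H^{(0)}\big)\ \ge\ \sum_{k=1}^n (d^{(0)})^{\downarrow}_k\,(\epsilon^{(0)})^{\uparrow}_k ,$$ where $\downarrow$ and $\uparrow$ denote the lists arranged in decreasing and increasing order, respectively. Moreover, this bound is saturated in the limit $N\to\infty$: there is a sequence of such cyclic protocols, with number of quenches tending to infinity, whose final energies $\mathrm{tr}(\omega^{(N)}_{\mathrm{GGE}}H^{(0)})$ converge to the right-hand side.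
   Context: The operators $a_i$ satisfy $\{a_i,a_j^\dagger\}=\delta_{i,j}$, $\{a_i,a_j\}=\{a_i^\dagger,a_j^\dagger\}=0$. The correlation matrix of a state $\rho$ is the $n\times n$ Hermitian matrix $\gamma(\rho)_{i,j}=\mathrm{tr}(a_i^\dagger a_j\rho)$; the energy of $\rho$ for $H=\sum c_{i,j}a_i^\dagger a_j$ is $\sum_{i,j}c_{i,j}\gamma(\rho)_{i,j}$. For a quadratic Hamiltonian $H=\sum_{i,j}c_{i,j}a_i^\dagger a_j$ with $c=ADA^\dagger$, $A$ unitary and $D=\mathrm{diag}(\epsilon_1,\dots,\epsilon_n)$, the normal modes are $\eta_k=\sum_jA_{j,k}^*a_j$, so that $H=\sum_k\epsilon_k\eta_k^\dagger\eta_k$. (If $c$ is degenerate, a diagonalising $A$ is chosen as part of the specification of the protocol.) The GGE equilibrium state reached from $\rho$ under $H$ is the state of maximal von Neumann entropy having the same expectation values of all $\eta_k^\dagger\eta_k$, $k=1,\dots,n$, as $\rho$; its correlation matrix is $A^*\,\Gamma[A^T\gamma(\rho)A^*]\,A^T$, where $\Gamma$ sets all off-diagonal entries of a matrix to zero. A protocol with $N$ quenches starts from $\omega^{(0)}_{\mathrm{GGE}}=\rho^{(0)}$; in step $m=1,\dots,N$ the Hamiltonian is quenched to $H^{(m)}$ with the state unchanged, and then the state is replaced by the GGE equilibrium state $\omega^{(m)}_{\mathrm{GGE}}$ reached from $\omega^{(m-1)}_{\mathrm{GGE}}$ under $H^{(m)}$. It is cyclic if $H^{(N)}=H^{(0)}$.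 *)

theory Defs
  imports
    Complex_Main
    "Jordan_Normal_Form.Char_Poly"
    "Jordan_Normal_Form.Schur_Decomposition"
begin

(* Conventions: modes, matrix rows and columns are numbered 0, ..., n - 1 instead of 1, ..., n;
   operators on the 2^n-dimensional Fock space are complex (2^n) x (2^n) matrices. *)

definition tr :: "complex mat \<Rightarrow> complex" where
  "tr M = (\<Sum>i<dim_row M. M $$ (i, i))"

definition hermitian_mat :: "nat \<Rightarrow> complex mat \<Rightarrow> bool" where
  "hermitian_mat n M \<longleftrightarrow> M \<in> carrier_mat n n \<and> mat_adjoint M = M"

definition unitary_mat :: "nat \<Rightarrow> complex mat \<Rightarrow> bool" where
  "unitary_mat n U \<longleftrightarrow> U \<in> carrier_mat n n \<and> mat_adjoint U * U = 1\<^sub>m n \<and> U * mat_adjoint U = 1\<^sub>m n"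

(* xs lists the eigenvalues, which are all real, with algebraic multiplicity. *)
definition real_eigenvalues :: "complex mat \<Rightarrow> real list \<Rightarrow> bool" where
  "real_eigenvalues M xs \<longleftrightarrow> char_poly M = (\<Prod>x\<leftarrow>xs. [:- complex_of_real x, 1:])"

(* Sums are written entrywise because matrices with dimensions in the terms form no
   additive monoid, so that sum is not available for them. *)
definition op_sum :: "nat \<Rightarrow> ('i \<Rightarrow> complex mat) \<Rightarrow> 'i set \<Rightarrow> complex mat" where
  "op_sum n f I = mat (2 ^ n) (2 ^ n) (\<lambda>rs. \<Sum>i\<in>I. f i $$ rs)"

definition anticommutator :: "complex mat \<Rightarrow> complex mat \<Rightarrow> complex mat" where
  "anticommutator X Y = X * Y + Y * X"

(* Canonical anticommutation relations of n modes. In dimension 2^n their representation is the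
   Fock representation, up to unitary equivalence; the operators are kept abstract. *)
definition fermion_ops :: "nat \<Rightarrow> (nat \<Rightarrow> complex mat) \<Rightarrow> bool" where
  "fermion_ops n a \<longleftrightarrow>
     (\<forall>i<n. a i \<in> carrier_mat (2 ^ n) (2 ^ n)) \<and>
     (\<forall>i<n. \<forall>j<n.
        anticommutator (a i) (mat_adjoint (a j)) = (if i = j then 1\<^sub>m (2 ^ n) else 0\<^sub>m (2 ^ n) (2 ^ n)) \<and>
        anticommutator (a i) (a j) = 0\<^sub>m (2 ^ n) (2 ^ n) \<and>
        anticommutator (mat_adjoint (a i)) (mat_adjoint (a j)) = 0\<^sub>m (2 ^ n) (2 ^ n))"

definition quadratic_hamiltonian :: "nat \<Rightarrow> (nat \<Rightarrow> complex mat) \<Rightarrow> complex mat \<Rightarrow> complex mat" where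
  "quadratic_hamiltonian n a c =
     op_sum n (\<lambda>(i, j). c $$ (i, j) \<cdot>\<^sub>m (mat_adjoint (a i) * a j)) ({..<n} \<times> {..<n})"

definition is_state :: "nat \<Rightarrow> complex mat \<Rightarrow> bool" where
  "is_state n \<rho> \<longleftrightarrow> hermitian_mat (2 ^ n) \<rho> \<and>
     (\<forall>v \<in> carrier_vec (2 ^ n). 0 \<le> Re ((\<rho> *\<^sub>v v) \<bullet>c v)) \<and> tr \<rho> = 1"

definition correlation_matrix :: "nat \<Rightarrow> (nat \<Rightarrow> complex mat) \<Rightarrow> complex mat \<Rightarrow> complex mat" where
  "correlation_matrix n a \<rho> = mat n n (\<lambda>(i, j). tr (mat_adjoint (a i) * a j * \<rho>))"

(* - tr (rho ln rho), as a sum over the eigenvalues of rho with multiplicity; 0 ln 0 = 0. *)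
definition von_neumann_entropy :: "complex mat \<Rightarrow> real" where
  "von_neumann_entropy \<rho> = - (\<Sum>z\<in>#proots (char_poly \<rho>). Re z * ln (Re z))"

(* The trace of a product of two Hermitian matrices is real, so Re discards nothing. *)
definition energy :: "complex mat \<Rightarrow> complex mat \<Rightarrow> real" where
  "energy \<rho> H = Re (tr (\<rho> * H))"

definition diagonalises :: "nat \<Rightarrow> complex mat \<Rightarrow> complex mat \<Rightarrow> bool" where
  "diagonalises n A c \<longleftrightarrow> unitary_mat n A \<and>
     (\<exists>\<epsilon> :: nat \<Rightarrow> real. c = A * mat_diag n (\<lambda>k. complex_of_real (\<epsilon> k)) * mat_adjoint A)"

definition normal_mode ::
  "nat \<Rightarrow> (nat \<Rightarrow> complex mat) \<Rightarrow> complex mat \<Rightarrow> nat \<Rightarrow> complex mat" where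
  "normal_mode n a A k = op_sum n (\<lambda>j. cnj (A $$ (j, k)) \<cdot>\<^sub>m a j) {..<n}"

definition occupation ::
  "nat \<Rightarrow> (nat \<Rightarrow> complex mat) \<Rightarrow> complex mat \<Rightarrow> nat \<Rightarrow> complex mat \<Rightarrow> complex" where
  "occupation n a A k \<rho> = tr (mat_adjoint (normal_mode n a A k) * normal_mode n a A k * \<rho>)"

(* omega is the GGE equilibrium state reached from rho; the quenched Hamiltonian enters through
   the chosen diagonalising unitary A, that is, through its normal modes. *)
definition gge_state ::
  "nat \<Rightarrow> (nat \<Rightarrow> complex mat) \<Rightarrow> complex mat \<Rightarrow> complex mat \<Rightarrow> complex mat \<Rightarrow> bool" where
  "gge_state n a A \<rho> \<omega> \<longleftrightarrow>
     is_state n \<omega> \<and> (\<forall>k<n. occupation n a A k \<omega> = occupation n a A k \<rho>) \<and>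
     (\<forall>\<sigma>. is_state n \<sigma> \<and> (\<forall>k<n. occupation n a A k \<sigma> = occupation n a A k \<rho>)
          \<longrightarrow> von_neumann_entropy \<sigma> \<le> von_neumann_entropy \<omega>)"

(* N quenches from (c0, rho0): c m is the coefficient matrix of the m-th Hamiltonian, A m the
   diagonalising unitary specified for it, omega m the state after m equilibrations. *)
definition gge_protocol ::
  "nat \<Rightarrow> (nat \<Rightarrow> complex mat) \<Rightarrow> complex mat \<Rightarrow> complex mat \<Rightarrow> nat \<Rightarrow>
   (nat \<Rightarrow> complex mat) \<Rightarrow> (nat \<Rightarrow> complex mat) \<Rightarrow> (nat \<Rightarrow> complex mat) \<Rightarrow> bool" where
  "gge_protocol n a c0 \<rho>0 N c A \<omega> \<longleftrightarrow>
     c 0 = c0 \<and> \<omega> 0 = \<rho>0 \<and>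
     (\<forall>m\<in>{1..N}. hermitian_mat n (c m) \<and> diagonalises n (A m) (c m) \<and>
                  gge_state n a (A m) (\<omega> (m - 1)) (\<omega> m))"

definition cyclic_gge_protocol ::
  "nat \<Rightarrow> (nat \<Rightarrow> complex mat) \<Rightarrow> complex mat \<Rightarrow> complex mat \<Rightarrow> nat \<Rightarrow>
   (nat \<Rightarrow> complex mat) \<Rightarrow> (nat \<Rightarrow> complex mat) \<Rightarrow> (nat \<Rightarrow> complex mat) \<Rightarrow> bool" where
  "cyclic_gge_protocol n a c0 \<rho>0 N c A \<omega> \<longleftrightarrow>
     1 \<le> N \<and> gge_protocol n a c0 \<rho>0 N c A \<omega> \<and>
     quadratic_hamiltonian n a (c N) = quadratic_hamiltonian n a (c 0)"

end

theory Submission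
  imports Defs "HOL-Analysis.Function_Topology" "HOL-Real_Asymp.Real_Asymp"
begin

text \<open>
  Deleting the off-diagonal entries of a state in a joint eigenbasis of the occupation operators keeps
  all occupations and strictly increases the entropy unless nothing was deleted. So a GGE state commutes
  with the occupation operators of its normal modes, and its correlation matrix is diagonal in them.
  On correlation matrices every equilibration thus acts as a unitary change of basis followed by the
  doubly stochastic matrix of transition probabilities on the eigenvalues, and so does the final
  evaluation of the energy; the rearrangement inequality for doubly stochastic matrices gives the bound.

  For the saturation, the eigenbasis of the initial correlation matrix is rotated along a one-parameter
  group onto the eigenbasis of the Hamiltonian, in \<open>M\<close> equal steps. Each equilibration then changes the
  occupations by \<open>O(1 / M\<^sup>2)\<close> only, hence all of them together by \<open>O(1 / M)\<close>.
\<close>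

subsection \<open>Adjoints and unitary matrices\<close>

text \<open>Occupations may equal 0 or 1, where the exponential form of a Gibbs state degenerates. A
  GGE state is therefore handled through its variational definition: existence comes from
  compactness of the set of probability vectors with prescribed occupations, diagonality from the
  equality case of the entropy inequality for dephasing. The modes are known only through their
  anticommutation relations; the joint eigenbasis of the occupation operators is obtained from their
  being commuting Hermitian projections. A correlation matrix carries the creation operator in its
  first index, so a Hamiltonian diagonalised by \<open>A\<close> corresponds to the basis
  \<open>mat_cnj A\<close> of correlation matrices. A rotation by time 1/M moves a mode into the
  others with amplitude O(1/M), hence with probability O(1/M^2); this is why M steps lose only
  O(1/M). All steps share one transition matrix, because the rotations form a one-parameter
  group.\<close>

abbreviation adj :: "complex mat \<Rightarrow> complex mat" where
  "adj \<equiv> mat_adjoint"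

lemma adj_dim [simp]: "dim_row (adj A) = dim_col A" "dim_col (adj A) = dim_row A"
  by (auto simp: mat_adjoint_def)

lemma adj_carrier [simp]: "A \<in> carrier_mat r c \<Longrightarrow> adj A \<in> carrier_mat c r"
  unfolding carrier_mat_def by simp

lemma adj_index [simp]: "i < dim_col A \<Longrightarrow> j < dim_row A \<Longrightarrow> adj A $$ (i, j) = cnj (A $$ (j, i))"
  by (auto simp: mat_adjoint_def mat_of_rows_def)

lemma adj_adj [simp]: "adj (adj A) = A"
  by (rule eq_matI) auto

lemma adj_one [simp]: "adj (1\<^sub>m n) = 1\<^sub>m n"
  by (rule eq_matI) auto

lemma mult_index:
  "A \<in> carrier_mat r m \<Longrightarrow> B \<in> carrier_mat m c \<Longrightarrow> i < r \<Longrightarrow> j < c \<Longrightarrow>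
    (A * B) $$ (i, j) = (\<Sum>k<m. A $$ (i, k) * B $$ (k, j))"
  by (auto simp: scalar_prod_def atLeast0LessThan intro!: sum.cong)

lemma adj_mult: "A \<in> carrier_mat r m \<Longrightarrow> B \<in> carrier_mat m c \<Longrightarrow> adj (A * B) = adj B * adj A"
  by (rule eq_matI) (auto simp: scalar_prod_def mult.commute intro!: sum.cong)

lemma adj_diag: "adj (mat_diag n f) = mat_diag n (\<lambda>i. cnj (f i))"
  by (rule eq_matI) (auto simp: mat_diag_def)

lemma mat_diag_carrier [simp, intro]: "mat_diag n f \<in> carrier_mat n n"
  by simp

lemma mat_diag_cong: "(\<And>i. i < n \<Longrightarrow> f i = g i) \<Longrightarrow> mat_diag n f = mat_diag n g"
  by (rule eq_matI) (auto simp: mat_diag_def)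

lemma unitary_carrier [simp]: "unitary_mat n U \<Longrightarrow> U \<in> carrier_mat n n"
  by (simp add: unitary_mat_def)

lemma unitary_left: "unitary_mat n U \<Longrightarrow> adj U * U = 1\<^sub>m n"
  and unitary_right: "unitary_mat n U \<Longrightarrow> U * adj U = 1\<^sub>m n"
  by (auto simp: unitary_mat_def)

lemma unitary_adj: "unitary_mat n U \<Longrightarrow> unitary_mat n (adj U)"
  by (auto simp: unitary_mat_def)

lemma unitaryI:
  assumes U: "U \<in> carrier_mat n n" and "adj U * U = 1\<^sub>m n"
  shows "unitary_mat n U"
  using mat_mult_left_right_inverse[OF adj_carrier[OF U] U assms(2)] assms by (simp add: unitary_mat_def)

lemma sq_mult_carrier [simp]:
  "A \<in> carrier_mat n n \<Longrightarrow> B \<in> carrier_mat n n \<Longrightarrow> A * B \<in> carrier_mat n n"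
  by (rule mult_carrier_mat)

lemma sq_assoc:
  "A \<in> carrier_mat n n \<Longrightarrow> B \<in> carrier_mat n n \<Longrightarrow> C \<in> carrier_mat n n \<Longrightarrow>
    A * B * C = A * (B * (C :: 'a :: semiring_0 mat))"
  by (rule assoc_mult_mat)

lemma cancel_left:
  "P * Q = 1\<^sub>m n \<Longrightarrow> P \<in> carrier_mat n n \<Longrightarrow> Q \<in> carrier_mat n n \<Longrightarrow> C \<in> carrier_mat n n \<Longrightarrow>
    P * (Q * C) = (C :: 'a :: semiring_1 mat)"
  by (simp flip: sq_assoc)

lemma unitary_cancel:
  assumes "unitary_mat n U" "C \<in> carrier_mat n n"
  shows "adj U * (U * C) = C" "U * (adj U * C) = C"
  using assms by (auto intro!: cancel_left simp: unitary_left unitary_right)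

lemma unitary_mult:
  assumes "unitary_mat n U" "unitary_mat n V"
  shows "unitary_mat n (U * V)"
proof (rule unitaryI)
  show "U * V \<in> carrier_mat n n" using assms by auto
  show "adj (U * V) * (U * V) = 1\<^sub>m n"
    using assms by (simp add: adj_mult[of _ n n _ n] sq_assoc[of _ n] unitary_cancel unitary_left)
qed

lemma unitary_one: "unitary_mat n (1\<^sub>m n)"
  by (rule unitaryI) auto

lemma unitary_diag:
  assumes "\<And>i. i < n \<Longrightarrow> cmod (f i) = 1"
  shows "unitary_mat n (mat_diag n f)"
proof (rule unitaryI)
  have "cnj (f i) * f i = 1" if "i < n" for i
    using assms[OF that] by (metis complex_norm_square mult.commute of_real_1 power_one)
  then show "adj (mat_diag n f) * mat_diag n f = 1\<^sub>m n"
    unfolding adj_diag by (auto simp flip: mat_diag_one intro!: mat_diag_cong)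
qed simp

subsection \<open>The spectral theorem for normal matrices\<close>

text \<open>Gram-Schmidt keeps its first vector, so a completion of \<open>v\<close> to a basis
  yields orthogonal columns led by \<open>v\<close>. Dividing each column by its norm makes the
  matrix unitary; \<open>c\<close> is the reciprocal norm of \<open>v\<close>. This prepares the
  deflation in \<open>normal_spectral\<close>.\<close>

lemma unitary_with_first_column:
  assumes v: "v \<in> carrier_vec n" "v \<noteq> 0\<^sub>v n"
  shows "\<exists>W c. unitary_mat n W \<and> c \<noteq> 0 \<and> (\<forall>i<n. W $$ (i, 0) = c * v $ i)"
proof -
  interpret cof_vec_space n "TYPE(complex)" .
  define b where "b = basis_completion v"
  define ws where "ws = gram_schmidt n b"
  from basis_completion[OF v, folded b_def]
  have b: "span (set b) = carrier_vec n" "distinct b" "\<not> lin_dep (set b)" "set b \<subseteq> carrier_vec n"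
    "hd b = v" "length b = n" by auto
  have n0: "n \<noteq> 0"
    using v by (metis carrier_vecD eq_vecI index_zero_vec(2) less_nat_zero_code)
  then obtain vs where bv: "b = v # vs" using b by (cases b) auto
  from gram_schmidt_result[OF b(4,2,3) refl, folded ws_def]
  have ws: "set ws \<subseteq> carrier_vec n" "corthogonal ws" "length ws = n"
    by (auto simp: b)
  have hd: "ws ! 0 = v"
    using gram_schmidt_hd[OF v(1), of vs, folded bv] ws n0 unfolding ws_def
    by (metis hd_conv_nth length_0_conv)
  have wsc: "ws ! i \<in> carrier_vec n" if "i < n" for i using ws that by auto
  define g where "g i = (\<Sum>k<n. (cmod (ws ! i $ k))\<^sup>2)" for i
  have prod: "(\<Sum>k<n. ws ! i $ k * cnj (ws ! j $ k)) = (if i = j then complex_of_real (g i) else 0)"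
    if "i < n" "j < n" for i j
  proof -
    have "(\<Sum>k<n. ws ! i $ k * cnj (ws ! j $ k)) = ws ! i \<bullet>c ws ! j"
      using wsc[OF that(1)] wsc[OF that(2)] by (auto simp: scalar_prod_def atLeast0LessThan intro!: sum.cong)
    moreover have "ws ! i \<bullet>c ws ! j = 0" if "i \<noteq> j"
      using corthogonalD[OF ws(2)] ws(3) \<open>i < n\<close> \<open>j < n\<close> that by auto
    ultimately show ?thesis
      by (auto simp: g_def complex_norm_square simp del: of_real_power)
  qed
  have g0: "g i > 0" if "i < n" for i
  proof -
    have "ws ! i \<bullet>c ws ! i \<noteq> 0" using corthogonalD[OF ws(2)] ws(3) that by auto
    moreover have "ws ! i \<bullet>c ws ! i = (\<Sum>k<n. ws ! i $ k * cnj (ws ! i $ k))"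
      using wsc[OF that] by (auto simp: scalar_prod_def atLeast0LessThan intro!: sum.cong)
    ultimately have "g i \<noteq> 0" using prod[OF that that] by auto
    moreover have "g i \<ge> 0" by (auto simp: g_def intro: sum_nonneg)
    ultimately show ?thesis by simp
  qed
  define W where "W = mat n n (\<lambda>(i, j). ws ! j $ i / complex_of_real (sqrt (g j)))"
  have W: "W \<in> carrier_mat n n" by (simp add: W_def)
  have "adj W * W = 1\<^sub>m n"
  proof (rule eq_matI)
    fix i j assume "i < dim_row (1\<^sub>m n)" "j < dim_col (1\<^sub>m n)"
    then have ij: "i < n" "j < n" by auto
    have "(adj W * W) $$ (i, j) = (\<Sum>k<n. cnj (ws ! i $ k / sqrt (g i)) * (ws ! j $ k / sqrt (g j)))"
      using ij W by (subst mult_index[of _ n n _ n]) (auto simp: W_def intro!: sum.cong)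
    also have "\<dots> = (\<Sum>k<n. ws ! j $ k * cnj (ws ! i $ k)) / (sqrt (g i) * sqrt (g j))"
      by (simp add: sum_divide_distrib mult.commute)
    also have "\<dots> = (1\<^sub>m n) $$ (i, j)"
      using ij g0[of i] by (auto simp: prod simp flip: of_real_mult)
    finally show "(adj W * W) $$ (i, j) = (1\<^sub>m n) $$ (i, j)" .
  qed (use W in auto)
  then have "unitary_mat n W" by (rule unitaryI[OF W])
  moreover have "\<forall>i<n. W $$ (i, 0) = inverse (complex_of_real (sqrt (g 0))) * v $ i"
    using n0 by (auto simp: W_def hd field_simps)
  moreover have "inverse (complex_of_real (sqrt (g 0))) \<noteq> 0"
    using g0[of 0] n0 by auto
  ultimately show ?thesis by (intro exI[of _ W] exI[of _ "inverse (complex_of_real (sqrt (g 0)))"] conjI)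
qed

lemma conj_similar:
  assumes U: "unitary_mat n U" and M: "M \<in> carrier_mat n n"
  shows "char_poly (U * M * adj U) = char_poly M"
proof -
  have "similar_mat_wit (U * M * adj U) M U (adj U)"
    using U M by (intro similar_mat_witI[of _ _ n]) (simp_all add: unitary_left unitary_right)
  then show ?thesis by (intro char_poly_similar) (auto simp: similar_mat_def)
qed

lemma adj_four_block_diag:
  assumes "A \<in> carrier_mat r r" "D \<in> carrier_mat m m"
  shows "adj (four_block_mat A (0\<^sub>m r m) (0\<^sub>m m r) D) =
    four_block_mat (adj A) (0\<^sub>m r m) (0\<^sub>m m r) (adj D)"
  using assms by (intro eq_matI) (auto simp: four_block_mat_def Let_def)

lemma mult_four_block_diag:
  assumes "A \<in> carrier_mat r r" "D \<in> carrier_mat m m" "A' \<in> carrier_mat r r" "D' \<in> carrier_mat m m"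
  shows "four_block_mat A (0\<^sub>m r m) (0\<^sub>m m r) D * four_block_mat A' (0\<^sub>m r m) (0\<^sub>m m r) D' =
    four_block_mat (A * A') (0\<^sub>m r m) (0\<^sub>m m r) (D * (D' :: complex mat))"
  using assms by (subst mult_four_block_mat[of _ r r _ m _ m _ _ r _ m]) auto

text \<open>Deflation, by induction on the list of eigenvalues. Normality is the common ground of
  the Hermitian matrices and of the unitary rotation between two eigenbases, which are both
  diagonalised later. The order of \<open>es\<close> is prescribed from outside, so that spectra can
  be taken sorted.\<close>

theorem normal_spectral:
  assumes "N \<in> carrier_mat n n" and "adj N * N = N * adj N"
    and "char_poly N = (\<Prod>e\<leftarrow>es. [:- e, 1:])"
  shows "\<exists>W. unitary_mat n W \<and> N = W * mat_diag n (\<lambda>i. es ! i) * adj W"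
  using assms
proof (induction es arbitrary: n N)
  case Nil
  with degree_monic_char_poly[of N n] have "n = 0" by simp
  with Nil have "N = 1\<^sub>m n * mat_diag n (\<lambda>i. [] ! i) * adj (1\<^sub>m n)"
    by (intro eq_matI) auto
  then show ?case using unitary_one by blast
next
  case (Cons e es)
  note N = Cons.prems(1)
  have e: "eigenvalue N e"
    unfolding eigenvalue_root_char_poly[OF N] Cons.prems by simp
  define v where "v = find_eigenvector N e"
  from find_eigenvector[OF N e] have ev: "v \<in> carrier_vec n" "v \<noteq> 0\<^sub>v n" "N *\<^sub>v v = e \<cdot>\<^sub>v v"
    using N unfolding v_def[symmetric] eigenvector_def by auto
  then have "n \<noteq> 0"
    by (metis carrier_vecD eq_vecI index_zero_vec(2) less_nat_zero_code)
  then obtain m where n: "n = Suc m" by (cases n) auto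
  obtain W c where W: "unitary_mat n W" and c: "c \<noteq> 0" "\<And>i. i < n \<Longrightarrow> W $$ (i, 0) = c * v $ i"
    using unitary_with_first_column[OF ev(1,2)] by blast
  have n0: "0 < n" using n by simp
  have Wc [simp]: "W \<in> carrier_mat n n" using W by simp
  define M where "M = adj W * N * W"
  have M: "M \<in> carrier_mat n n" using W N by (simp add: M_def)
  have NM: "N = W * M * adj W"
    using W N by (simp add: M_def sq_assoc[of _ n] unitary_cancel unitary_right)
  have M0: "M $$ (i, 0) = (if i = 0 then e else 0)" if i: "i < n" for i
  proof -
    have NW: "(N * W) $$ (k, 0) = e * W $$ (k, 0)" if k: "k < n" for k
    proof -
      have "(N * W) $$ (k, 0) = c * (\<Sum>j<n. N $$ (k, j) * v $ j)"
        using N n0 k by (subst mult_index[of _ n n _ n])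
          (auto simp: c sum_distrib_left mult.left_commute)
      also have "(\<Sum>j<n. N $$ (k, j) * v $ j) = (N *\<^sub>v v) $ k"
        using N k carrier_vecD[OF ev(1)] unfolding mult_mat_vec_def
        by (auto simp: scalar_prod_def atLeast0LessThan intro!: sum.cong)
      finally show ?thesis using ev k by (simp add: c)
    qed
    have "M $$ (i, 0) = (adj W * (N * W)) $$ (i, 0)"
      using N W by (simp add: M_def sq_assoc[of _ n])
    also have "\<dots> = (\<Sum>k<n. adj W $$ (i, k) * (N * W) $$ (k, 0))"
      using N n0 i by (subst mult_index[of _ n n _ n]) auto
    also have "\<dots> = (\<Sum>k<n. e * (adj W $$ (i, k) * W $$ (k, 0)))"
      by (intro sum.cong) (auto simp: NW)
    also have "\<dots> = e * (adj W * W) $$ (i, 0)"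
      using n0 i by (subst mult_index[of "adj W" n n W n]) (auto simp: sum_distrib_left)
    finally show ?thesis using i n by (simp add: unitary_left[OF W])
  qed
  have Mnormal: "adj M * M = M * adj M"
  proof -
    have *: "adj M = adj W * adj N * W"
      using W N by (simp add: M_def adj_mult[of _ n n _ n] sq_assoc[of _ n])
    have "adj M * M = adj W * (adj N * N) * W"
      using W N unfolding * by (simp add: M_def sq_assoc[of _ n] unitary_cancel)
    also have "\<dots> = M * adj M"
      using W N unfolding * Cons.prems(2) by (simp add: M_def sq_assoc[of _ n] unitary_cancel)
    finally show ?thesis .
  qed
  \<comment> \<open>The (0, 0) entries of \<open>adj M * M\<close> and \<open>M * adj M\<close> are
    the squared norms of the first column and of the first row. The column consists of
    \<open>e\<close> alone and the row contains \<open>e\<close> too, so equality leaves nothing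
    else in the row.\<close>
  have row0: "M $$ (0, j) = 0" if j: "0 < j" "j < n" for j
  proof -
    have "(adj M * M) $$ (0, 0) = (\<Sum>k<n. cnj (M $$ (k, 0)) * M $$ (k, 0))"
      using M n by (subst mult_index[of _ n n _ n]) (auto intro!: sum.cong)
    also have "\<dots> = (\<Sum>k<n. if k = 0 then cnj e * e else 0)"
      by (intro sum.cong) (auto simp: M0)
    also have "\<dots> = cnj e * e" using n by simp
    finally have 1: "(adj M * M) $$ (0, 0) = complex_of_real ((cmod e)\<^sup>2)"
      by (simp only: complex_norm_square mult.commute)
    have "(M * adj M) $$ (0, 0) = (\<Sum>k<n. M $$ (0, k) * cnj (M $$ (0, k)))"
      using M n by (subst mult_index[of _ n n _ n]) (auto intro!: sum.cong)
    also have "\<dots> = complex_of_real (\<Sum>k<n. (cmod (M $$ (0, k)))\<^sup>2)"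
      by (simp only: complex_norm_square of_real_sum)
    also have "(\<Sum>k<n. (cmod (M $$ (0, k)))\<^sup>2) = (cmod e)\<^sup>2 + (\<Sum>k\<in>{..<n} - {0}. (cmod (M $$ (0, k)))\<^sup>2)"
      using n M0[of 0] by (subst sum.remove[of _ 0]) auto
    finally have "(\<Sum>k\<in>{..<n} - {0}. (cmod (M $$ (0, k)))\<^sup>2) = 0"
      using 1 Mnormal by (metis add_cancel_right_right of_real_eq_iff)
    then have "\<forall>k\<in>{..<n} - {0}. (cmod (M $$ (0, k)))\<^sup>2 = 0"
      by (subst (asm) sum_nonneg_eq_0_iff) auto
    then show ?thesis using j by auto
  qed
  define E where "E = mat 1 1 (\<lambda>_. e)"
  define A where "A = mat m m (\<lambda>(i, j). M $$ (Suc i, Suc j))"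
  have E: "E \<in> carrier_mat 1 1" and A: "A \<in> carrier_mat m m" by (auto simp: E_def A_def)
  have MB: "M = four_block_mat E (0\<^sub>m 1 m) (0\<^sub>m m 1) A"
    using M n M0 row0 by (intro eq_matI) (auto simp: E_def A_def four_block_mat_def Let_def)
  have cp: "char_poly M = [:-e, 1:] * (\<Prod>e\<leftarrow>es. [:- e, 1:])"
    using Cons.prems(3) conj_similar[OF W M] NM by simp
  also have "char_poly M = char_poly E * char_poly A"
    unfolding MB by (rule char_poly_four_block_zeros_col[OF E _ A]) simp
  also have "char_poly E = [:-e, 1:]"
    by (simp add: E_def char_poly_defs det_def sign_def)
  finally have cpA: "char_poly A = (\<Prod>e\<leftarrow>es. [:- e, 1:])"
    by (metis mult_cancel_left pCons_eq_0_iff zero_neq_one)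
  have "four_block_mat (adj E * E) (0\<^sub>m 1 m) (0\<^sub>m m 1) (adj A * A) =
        four_block_mat (E * adj E) (0\<^sub>m 1 m) (0\<^sub>m m 1) (A * adj A)"
    using Mnormal unfolding MB adj_four_block_diag[OF E A]
      mult_four_block_diag[OF adj_carrier[OF E] adj_carrier[OF A] E A]
      mult_four_block_diag[OF E A adj_carrier[OF E] adj_carrier[OF A]] .
  then have blk: "four_block_mat (adj E * E) (0\<^sub>m 1 m) (0\<^sub>m m 1) (adj A * A) $$ (Suc i, Suc j) =
      four_block_mat (E * adj E) (0\<^sub>m 1 m) (0\<^sub>m m 1) (A * adj A) $$ (Suc i, Suc j)" for i j
    by simp
  have "adj A * A = A * adj A"
  proof (rule eq_matI)
    fix i j assume "i < dim_row (A * adj A)" "j < dim_col (A * adj A)"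
    then show "(adj A * A) $$ (i, j) = (A * adj A) $$ (i, j)"
      using blk[of i j] E A by (simp add: four_block_mat_def Let_def)
  qed (use A in auto)
  from Cons.IH[OF A this cpA] obtain P where P: "unitary_mat m P"
    "A = P * mat_diag m ((!) es) * adj P" by blast
  define Q where "Q = four_block_mat (1\<^sub>m 1) (0\<^sub>m 1 m) (0\<^sub>m m 1) P"
  note Pc = unitary_carrier[OF P(1)]
  have Qc: "Q \<in> carrier_mat n n" using Pc n by (auto simp: Q_def)
  have Q: "unitary_mat n Q"
  proof (rule unitaryI[OF Qc])
    have "adj Q * Q = four_block_mat (1\<^sub>m 1) (0\<^sub>m 1 m) (0\<^sub>m m 1) (1\<^sub>m m)"
      unfolding Q_def using Pc P(1)
      by (subst adj_four_block_diag) (auto simp: mult_four_block_diag unitary_left)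
    also have "\<dots> = 1\<^sub>m n"
      using n by (intro eq_matI) (auto simp: four_block_mat_def Let_def)
    finally show "adj Q * Q = 1\<^sub>m n" .
  qed
  have D: "mat_diag n ((!) (e # es)) = four_block_mat E (0\<^sub>m 1 m) (0\<^sub>m m 1) (mat_diag m ((!) es))"
    using n by (intro eq_matI) (auto simp: E_def four_block_mat_def Let_def mat_diag_def nth_Cons split: nat.splits)
  have MQ: "M = Q * mat_diag n ((!) (e # es)) * adj Q"
    unfolding MB D Q_def using Pc E
    by (subst adj_four_block_diag) (simp_all add: mult_four_block_diag[of _ 1 _ m] P(2) del: One_nat_def)
  have "N = (W * Q) * mat_diag n ((!) (e # es)) * adj (W * Q)"
    using W Qc unfolding NM MQ by (simp add: sq_assoc[of _ n] adj_mult[of _ n n _ n])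
  then show ?case using unitary_mult[OF W Q] by blast
qed

section \<open>Diagonal matrices in rotated bases; Hermitian and unitary matrices\<close>

lemma conj_diag_index:
  assumes "G \<in> carrier_mat n n" "k < n" "l < n"
  shows "(G * mat_diag n f * adj G) $$ (k, l) = (\<Sum>j<n. G $$ (k, j) * f j * cnj (G $$ (l, j)))"
  using assms mult_carrier_mat[OF assms(1) mat_diag_carrier[of n f]]
  by (subst mult_index[of _ n n _ n]) (auto simp: mat_diag_mult_right[of _ n n])

text \<open>The source of the transition probabilities: in a rotated basis the diagonal entries are
  averages of the spectrum with weights |G(k, j)|^2.\<close>

lemma conj_diag_index_real:
  assumes "G \<in> carrier_mat n n" "k < n"
  shows "(G * mat_diag n (\<lambda>i. complex_of_real (p i)) * adj G) $$ (k, k) =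
    complex_of_real (\<Sum>j<n. (cmod (G $$ (k, j)))\<^sup>2 * p j)"
  unfolding conj_diag_index[OF assms assms(2)]
  by (simp add: complex_norm_square mult_ac del: of_real_power)

lemma conj_cancel:
  assumes "unitary_mat n U" "M \<in> carrier_mat n n"
  shows "adj U * (U * M * adj U) * U = M" "U * (adj U * M * U) * adj U = M"
  using assms by (simp_all add: sq_assoc[of _ n] unitary_cancel unitary_left unitary_right)

lemma conj_eqD:
  assumes "unitary_mat n U" "M \<in> carrier_mat n n" "M' \<in> carrier_mat n n"
    and "U * M * adj U = U * M' * adj U"
  shows "M = M'"
  using assms conj_cancel(1) by metis

lemma adj_conj:
  assumes "U \<in> carrier_mat n n" "M \<in> carrier_mat n n"
  shows "adj (U * M * adj U) = U * adj M * adj U"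
  using assms by (simp add: sq_assoc[of _ n] adj_mult[of _ n n _ n])

lemma conj_mult:
  assumes "unitary_mat n U" "M \<in> carrier_mat n n" "M' \<in> carrier_mat n n"
  shows "(U * M * adj U) * (U * M' * adj U) = U * (M * M') * adj U"
  using assms by (simp add: sq_assoc[of _ n] unitary_cancel)

lemma conj_conj:
  assumes "U \<in> carrier_mat n n" "V \<in> carrier_mat n n" "M \<in> carrier_mat n n"
  shows "U * (V * M * adj V) * adj U = (U * V) * M * adj (U * V)"
  using assms by (simp add: sq_assoc[of _ n] adj_mult[of _ n n _ n])

lemma mat_diag_index [simp]: "i < n \<Longrightarrow> mat_diag n f $$ (i, i) = f i"
  by (simp add: mat_diag_def)

lemma mat_diag_dims [simp]: "dim_row (mat_diag n f) = n" "dim_col (mat_diag n f) = n"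
  by (simp_all add: mat_diag_def)

lemma hermitian_spectral:
  assumes M: "hermitian_mat n M" and "char_poly M = (\<Prod>e\<leftarrow>es. [:- e, 1:])"
  shows "\<exists>W. unitary_mat n W \<and> M = W * mat_diag n (\<lambda>i. es ! i) * adj W"
  using assms normal_spectral[of M n es] by (simp add: hermitian_mat_def)

lemma hermitian_diagonalise:
  assumes M: "hermitian_mat n M"
  shows "\<exists>W (p :: nat \<Rightarrow> real). unitary_mat n W \<and> M = W * mat_diag n (\<lambda>i. complex_of_real (p i)) * adj W"
proof -
  have Mc: "M \<in> carrier_mat n n" "adj M = M" using M by (auto simp: hermitian_mat_def)
  obtain es where "char_poly M = (\<Prod>e\<leftarrow>es. [:- e, 1:])"
    using char_poly_factorized[OF Mc(1)] by blast
  then obtain W where W: "unitary_mat n W" "M = W * mat_diag n ((!) es) * adj W"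
    using hermitian_spectral[OF M] by blast
  \<comment> \<open>The roots of the characteristic polynomial are a priori complex. Conjugation by
    \<open>W\<close> is injective, so \<open>adj M = M\<close> makes the diagonal factor its own
    adjoint, that is, real.\<close>
  have "W * adj (mat_diag n ((!) es)) * adj W = W * mat_diag n ((!) es) * adj W"
    using Mc(2) unfolding W(2) adj_conj[OF unitary_carrier[OF W(1)] mat_diag_carrier] .
  then have "adj (mat_diag n ((!) es)) = mat_diag n ((!) es)"
    by (rule conj_eqD[OF W(1) adj_carrier[OF mat_diag_carrier] mat_diag_carrier])
  then have "cnj (es ! i) = es ! i" if "i < n" for i
    using that by (metis adj_index mat_diag_dims mat_diag_index)
  then have "mat_diag n ((!) es) = mat_diag n (\<lambda>i. complex_of_real (Re (es ! i)))"
    by (intro mat_diag_cong) (auto simp: complex_eq_iff)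
  then show ?thesis using W by auto
qed

text \<open>The diagonal factor is itself unitary, so its entries have modulus 1. Writing them
  through angles allows interpolation between the identity and \<open>U\<close>: scaling the angles
  by t gives the one-parameter group of the slow rotation.\<close>

lemma unitary_diagonalise:
  assumes U: "unitary_mat n U"
  shows "\<exists>X \<theta>. unitary_mat n X \<and> U = X * mat_diag n (\<lambda>i. cis (\<theta> i)) * adj X"
proof -
  have Uc: "U \<in> carrier_mat n n" using U by simp
  obtain es where "char_poly U = (\<Prod>e\<leftarrow>es. [:- e, 1:])"
    using char_poly_factorized[OF Uc] by blast
  then obtain X where X: "unitary_mat n X" "U = X * mat_diag n ((!) es) * adj X"
    using normal_spectral[OF Uc] U by (auto simp: unitary_left unitary_right)
  have "mat_diag n ((!) es) = adj X * U * X"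
    unfolding X(2) by (rule conj_cancel(1)[OF X(1) mat_diag_carrier, symmetric])
  then have "unitary_mat n (mat_diag n ((!) es))"
    using U X(1) by (simp add: unitary_mult unitary_adj)
  then have one: "mat_diag n (\<lambda>i. cnj (es ! i) * es ! i) = 1\<^sub>m n"
    using unitary_left[of n "mat_diag n ((!) es)"] by (simp add: adj_diag)
  have "cis (Arg (es ! i)) = es ! i" if "i < n" for i
  proof -
    have "cnj (es ! i) * es ! i = 1"
      using that arg_cong[OF one, of "\<lambda>M. M $$ (i, i)"] by simp
    then have "complex_of_real ((cmod (es ! i))\<^sup>2) = 1"
      unfolding complex_norm_square by (simp add: mult.commute)
    then have "cmod (es ! i) = 1"
      unfolding of_real_eq_1_iff using norm_ge_zero[of "es ! i"] by (auto simp: power2_eq_1_iff simp del: norm_ge_zero)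
    moreover from this have "es ! i \<noteq> 0" by auto
    ultimately show ?thesis by (simp add: cis_Arg sgn_eq)
  qed
  then have "mat_diag n ((!) es) = mat_diag n (\<lambda>i. cis (Arg (es ! i)))"
    by (intro mat_diag_cong) simp
  then show ?thesis using X by (intro exI[of _ X] exI[of _ "\<lambda>i. Arg (es ! i)"]) auto
qed

subsection \<open>Doubly stochastic matrices\<close>

definition doubly_stochastic :: "nat \<Rightarrow> (nat \<Rightarrow> nat \<Rightarrow> real) \<Rightarrow> bool" where
  "doubly_stochastic n D \<longleftrightarrow> (\<forall>i<n. \<forall>j<n. 0 \<le> D i j) \<and>
     (\<forall>i<n. (\<Sum>j<n. D i j) = 1) \<and> (\<forall>j<n. (\<Sum>i<n. D i j) = 1)"

lemma doubly_stochastic_unitary: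
  assumes U: "unitary_mat n U"
  shows "doubly_stochastic n (\<lambda>i j. (cmod (U $$ (i, j)))\<^sup>2)"
proof -
  have row: "(\<Sum>j<n. (cmod (V $$ (i, j)))\<^sup>2) = 1" if V: "unitary_mat n V" and i: "i < n" for V i
  proof -
    have "complex_of_real (\<Sum>j<n. (cmod (V $$ (i, j)))\<^sup>2) = (V * adj V) $$ (i, i)"
      using conj_diag_index_real[OF unitary_carrier[OF V] i, of "\<lambda>_. 1"] V
      by (simp add: right_mult_one_mat[OF unitary_carrier[OF V]] del: of_real_power of_real_sum index_mult_mat)
    then show ?thesis using i by (simp add: unitary_right[OF V] del: of_real_sum of_real_power)
  qed
  have "(\<Sum>i<n. (cmod (U $$ (i, j)))\<^sup>2) = 1" if j: "j < n" for j
  proof -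
    have "(\<Sum>i<n. (cmod (U $$ (i, j)))\<^sup>2) = (\<Sum>i<n. (cmod (adj U $$ (j, i)))\<^sup>2)"
      using j unitary_carrier[OF U] by (intro sum.cong) auto
    then show ?thesis using row[OF unitary_adj[OF U] j] by simp
  qed
  then show ?thesis using row[OF U] by (auto simp: doubly_stochastic_def)
qed

lemma doubly_stochastic_mult:
  assumes "doubly_stochastic n D" "doubly_stochastic n E"
  shows "doubly_stochastic n (\<lambda>i j. \<Sum>k<n. D i k * E k j)"
proof -
  have "(\<Sum>j<n. \<Sum>k<n. D i k * E k j) = 1" if "i < n" for i
    using assms that by (subst sum.swap) (simp add: doubly_stochastic_def flip: sum_distrib_left)
  moreover have "(\<Sum>i<n. \<Sum>k<n. D i k * E k j) = 1" if "j < n" for j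
    using assms that by (subst sum.swap) (simp add: doubly_stochastic_def flip: sum_distrib_right)
  ultimately show ?thesis
    using assms by (auto simp: doubly_stochastic_def intro!: sum_nonneg)
qed

text \<open>Linear programming duality: the potentials \<open>u i\<close> and \<open>x j * y j - u j\<close> sum to at most
  \<open>x i * y j\<close>, with equality on the diagonal.\<close>

lemma rearrangement_doubly_stochastic:
  fixes x y :: "nat \<Rightarrow> real"
  assumes D: "doubly_stochastic n D"
    and x: "\<And>i j. i \<le> j \<Longrightarrow> j < n \<Longrightarrow> x i \<le> x j"
    and y: "\<And>i j. i \<le> j \<Longrightarrow> j < n \<Longrightarrow> y j \<le> y i"
  shows "(\<Sum>k<n. x k * y k) \<le> (\<Sum>i<n. \<Sum>j<n. x i * D i j * y j)"
proof -
  \<comment> \<open>\<open>u\<close> integrates \<open>y\<close> against the increments of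
    \<open>x\<close>. Seen as a function of \<open>x\<close> it has the decreasing slopes
    \<open>y k\<close>, so it is concave; \<open>up\<close> and \<open>down\<close> say that it
    stays below its tangent of slope \<open>y j\<close> at \<open>x j\<close>.\<close>
  define u where "u i = (\<Sum>k<i. (x (Suc k) - x k) * y k)" for i
  have up: "u i - u j \<le> (x i - x j) * y j" if "j \<le> i" "i < n" for i j
    using that
  proof (induction i rule: dec_induct)
    case (step i)
    have "(x (Suc i) - x i) * y i \<le> (x (Suc i) - x i) * y j"
      using step x[of i "Suc i"] y[of j i] by (intro mult_left_mono) auto
    then show ?case using step by (simp add: u_def algebra_simps)
  qed simp
  have down: "u i - u j \<le> (x i - x j) * y j" if "i \<le> j" "j < n" for i j
    using that
  proof (induction j rule: dec_induct)
    case (step j)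
    have "(x (Suc j) - x i) * y (Suc j) \<le> (x (Suc j) - x i) * y j"
      using step x[of i "Suc j"] y[of j "Suc j"] by (intro mult_left_mono) auto
    then show ?case using step by (simp add: u_def algebra_simps)
  qed simp
  have le: "u i + (x j * y j - u j) \<le> x i * y j" if "i < n" "j < n" for i j
    using up[of j i] down[of i j] that by (cases "j \<le> i") (auto simp: algebra_simps)
  have "(\<Sum>k<n. x k * y k) = (\<Sum>i<n. u i) + (\<Sum>j<n. x j * y j - u j)"
    by (simp add: sum_subtractf)
  also have "(\<Sum>i<n. u i) = (\<Sum>i<n. \<Sum>j<n. D i j * u i)"
    using D by (simp add: doubly_stochastic_def flip: sum_distrib_right)
  also have "(\<Sum>j<n. x j * y j - u j) = (\<Sum>j<n. \<Sum>i<n. D i j * (x j * y j - u j))"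
    using D by (simp add: doubly_stochastic_def flip: sum_distrib_right)
  also have "\<dots> = (\<Sum>i<n. \<Sum>j<n. D i j * (x j * y j - u j))"
    by (rule sum.swap)
  also have "(\<Sum>i<n. \<Sum>j<n. D i j * u i) + \<dots> = (\<Sum>i<n. \<Sum>j<n. D i j * (u i + (x j * y j - u j)))"
    by (simp only: sum.distrib distrib_left)
  also have "\<dots> \<le> (\<Sum>i<n. \<Sum>j<n. D i j * (x i * y j))"
    using D le by (intro sum_mono mult_left_mono) (auto simp: doubly_stochastic_def)
  finally show ?thesis by (simp add: mult_ac)
qed

subsection \<open>States and entropy\<close>

lemma tr_mult_comm:
  assumes "A \<in> carrier_mat r m" "B \<in> carrier_mat m r"
  shows "tr (A * B) = tr (B * A)"
proof -
  have "tr (A * B) = (\<Sum>i<r. \<Sum>k<m. A $$ (i, k) * B $$ (k, i))"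
    using assms by (auto simp: tr_def mult_index[of A r m B r] simp del: index_mult_mat(1))
  also have "\<dots> = (\<Sum>k<m. \<Sum>i<r. B $$ (k, i) * A $$ (i, k))"
    by (subst sum.swap) (simp add: mult.commute)
  also have "\<dots> = tr (B * A)"
    using assms by (auto simp: tr_def mult_index[of B m r A m] simp del: index_mult_mat(1))
  finally show ?thesis .
qed

lemma tr_conj:
  assumes "unitary_mat n U" "M \<in> carrier_mat n n"
  shows "tr (U * M * adj U) = tr M" "tr (adj U * M * U) = tr M"
proof -
  show "tr (U * M * adj U) = tr M"
    using assms by (subst tr_mult_comm[of _ n n]) (auto simp: unitary_cancel)
  show "tr (adj U * M * U) = tr M"
    using assms by (subst tr_mult_comm[of _ n n]) (auto simp: unitary_cancel)
qed

lemma tr_diag: "tr (mat_diag n f) = (\<Sum>i<n. f i)"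
  by (simp add: tr_def)

section \<open>Density matrices as probability vectors in an eigenbasis\<close>

lemma quadratic_form_col:
  assumes M: "M \<in> carrier_mat n n" and V: "V \<in> carrier_mat n n" and j: "j < n"
  shows "(M *\<^sub>v col V j) \<bullet>c col V j = (adj V * M * V) $$ (j, j)"
proof -
  have "(M *\<^sub>v col V j) \<bullet>c col V j = (\<Sum>i<n. (M * V) $$ (i, j) * cnj (V $$ (i, j)))"
    using M V j by (auto simp: scalar_prod_def atLeast0LessThan intro!: sum.cong)
  also have "\<dots> = (adj V * (M * V)) $$ (j, j)"
    using M V j by (subst mult_index[of _ n n _ n]) (auto simp: mult.commute intro!: sum.cong)
  finally show ?thesis using M V by (simp add: sq_assoc[of _ n])
qed

lemma quadratic_form_conj_diag:
  assumes V: "V \<in> carrier_mat n n" and v: "v \<in> carrier_vec n"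
  shows "((V * mat_diag n (\<lambda>i. complex_of_real (p i)) * adj V) *\<^sub>v v) \<bullet>c v =
    complex_of_real (\<Sum>j<n. p j * (cmod ((adj V *\<^sub>v v) $ j))\<^sup>2)"
proof -
  define w where "w = adj V *\<^sub>v v"
  have w: "w \<in> carrier_vec n"
    unfolding w_def by (rule mult_mat_vec_carrier[OF adj_carrier[OF V] v])
  have wj: "w $ j = (\<Sum>i<n. cnj (V $$ (i, j)) * v $ i)" if "j < n" for j
    using V v that by (auto simp: w_def scalar_prod_def atLeast0LessThan intro!: sum.cong)
  have "((V * mat_diag n (\<lambda>i. complex_of_real (p i)) * adj V) *\<^sub>v v) =
      V *\<^sub>v (mat_diag n (\<lambda>i. complex_of_real (p i)) *\<^sub>v w)"
    unfolding w_def using V v mult_mat_vec_carrier[OF adj_carrier[OF V] v]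
    by (simp add: assoc_mult_mat_vec[of _ n n _ n])
  also have "\<dots> = vec n (\<lambda>i. \<Sum>j<n. V $$ (i, j) * (p j * w $ j))"
    using V w by (intro eq_vecI)
      (auto simp: scalar_prod_def atLeast0LessThan mat_diag_def if_distrib[of "\<lambda>x. x * _"] cong: if_cong intro!: sum.cong)
  finally have "((V * mat_diag n (\<lambda>i. complex_of_real (p i)) * adj V) *\<^sub>v v) \<bullet>c v =
      (\<Sum>i<n. (\<Sum>j<n. V $$ (i, j) * (p j * w $ j)) * cnj (v $ i))"
    using v by (auto simp: scalar_prod_def atLeast0LessThan intro!: sum.cong)
  also have "\<dots> = (\<Sum>j<n. p j * w $ j * (\<Sum>i<n. V $$ (i, j) * cnj (v $ i)))"
    unfolding sum_distrib_left sum_distrib_right by (subst sum.swap) (simp add: mult_ac)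
  also have "\<dots> = (\<Sum>j<n. p j * (w $ j * cnj (w $ j)))"
    by (intro sum.cong) (auto simp: wj)
  also have "\<dots> = complex_of_real (\<Sum>j<n. p j * (cmod (w $ j))\<^sup>2)"
    by (simp add: complex_norm_square del: of_real_power)
  finally show ?thesis by (simp add: w_def)
qed

text \<open>Used in both directions, to read off the spectrum of a state and to build states from
  probability vectors. Testing positivity on a column of \<open>V\<close> isolates a single
  \<open>p i\<close>; conversely the quadratic form is a combination of the \<open>p j\<close> with
  nonnegative coefficients.\<close>

lemma is_state_conj_diag:
  assumes V: "unitary_mat (2 ^ n) V"
  shows "is_state n (V * mat_diag (2 ^ n) (\<lambda>i. complex_of_real (p i)) * adj V) \<longleftrightarrow>
    (\<forall>i<2 ^ n. 0 \<le> p i) \<and> (\<Sum>i<2 ^ n. p i) = 1" (is "is_state n ?\<rho> \<longleftrightarrow> _")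
proof -
  have herm: "hermitian_mat (2 ^ n) ?\<rho>"
    using V unfolding hermitian_mat_def adj_conj[OF unitary_carrier[OF V] mat_diag_carrier] adj_diag
    by simp
  have "tr ?\<rho> = complex_of_real (\<Sum>i<2 ^ n. p i)"
    unfolding tr_conj(1)[OF V mat_diag_carrier] by (simp add: tr_diag)
  then have trace: "tr ?\<rho> = 1 \<longleftrightarrow> (\<Sum>i<2 ^ n. p i) = 1"
    by (simp only: of_real_eq_1_iff)
  have pos: "(\<forall>v \<in> carrier_vec (2 ^ n). 0 \<le> Re ((?\<rho> *\<^sub>v v) \<bullet>c v)) \<longleftrightarrow> (\<forall>i<2 ^ n. 0 \<le> p i)"
  proof
    assume *: "\<forall>v \<in> carrier_vec (2 ^ n). 0 \<le> Re ((?\<rho> *\<^sub>v v) \<bullet>c v)"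
    show "\<forall>i<2 ^ n. 0 \<le> p i"
    proof (intro allI impI)
      fix i :: nat assume i: "i < 2 ^ n"
      have "col V i \<in> carrier_vec (2 ^ n)" using col_dim[of V i] unitary_carrier[OF V] by (metis carrier_matD(1))
      with * have "0 \<le> Re ((?\<rho> *\<^sub>v col V i) \<bullet>c col V i)" by blast
      then show "0 \<le> p i"
        using i V quadratic_form_col[OF _ unitary_carrier[OF V] i, of ?\<rho>] conj_cancel(1)[OF V mat_diag_carrier]
        by simp
    qed
  next
    assume p: "\<forall>i<2 ^ n. 0 \<le> p i"
    show "\<forall>v \<in> carrier_vec (2 ^ n). 0 \<le> Re ((?\<rho> *\<^sub>v v) \<bullet>c v)"
    proof
      fix v :: "complex vec" assume v: "v \<in> carrier_vec (2 ^ n)"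
      show "0 \<le> Re ((?\<rho> *\<^sub>v v) \<bullet>c v)"
        unfolding quadratic_form_conj_diag[OF unitary_carrier[OF V] v] Re_complex_of_real
        using p by (intro sum_nonneg mult_nonneg_nonneg) auto
    qed
  qed
  show ?thesis unfolding is_state_def by (simp only: herm trace pos simp_thms)
qed

lemma state_diagonalise:
  assumes "is_state n \<rho>"
  obtains U p where "unitary_mat (2 ^ n) U" "\<rho> = U * mat_diag (2 ^ n) (\<lambda>i. complex_of_real (p i)) * adj U"
    "\<And>i. i < 2 ^ n \<Longrightarrow> 0 \<le> p i" "(\<Sum>i<2 ^ n. p i) = 1"
proof -
  from assms have "hermitian_mat (2 ^ n) \<rho>" by (simp add: is_state_def)
  from hermitian_diagonalise[OF this] obtain U p where U: "unitary_mat (2 ^ n) U"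
    "\<rho> = U * mat_diag (2 ^ n) (\<lambda>i. complex_of_real (p i)) * adj U" by blast
  have "(\<forall>i<2 ^ n. 0 \<le> p i) \<and> (\<Sum>i<2 ^ n. p i) = 1"
    using assms unfolding U(2) is_state_conj_diag[OF U(1)] .
  then show thesis by (intro that[OF U]) auto
qed

section \<open>Entropy as a function of the spectrum, and its growth under dephasing\<close>

lemma char_poly_conj_diag:
  assumes "unitary_mat n U"
  shows "char_poly (U * mat_diag n f * adj U) = (\<Prod>x\<leftarrow>map f [0..<n]. [:- x, 1:])"
proof -
  have "upper_triangular (mat_diag n f)" "diag_mat (mat_diag n f) = map f [0..<n]"
    by (auto simp: mat_diag_def diag_mat_def)
  then show ?thesis
    using conj_similar[OF assms mat_diag_carrier] char_poly_upper_triangular[OF mat_diag_carrier[of n f]] by simp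
qed

lemma entropy_conj_diag:
  assumes "unitary_mat n U"
  shows "von_neumann_entropy (U * mat_diag n (\<lambda>i. complex_of_real (p i)) * adj U) = - (\<Sum>i<n. p i * ln (p i))"
proof -
  have proots: "proots (\<Prod>x\<leftarrow>xs. [:- x, 1:]) = mset xs" for xs :: "complex list"
  proof (induction xs)
    case (Cons x xs)
    have "proots ([:- x, 1:] * (\<Prod>x\<leftarrow>xs. [:- x, 1:])) = {#x#} + mset xs"
      by (subst proots_mult) (auto simp: Cons prod_list_zero_iff)
    then show ?case by simp
  qed simp
  show ?thesis
    unfolding von_neumann_entropy_def char_poly_conj_diag[OF assms] proots
    unfolding mset_map[symmetric] sum_mset_sum_list map_map o_def interv_sum_list_conv_sum_set_nat
    by (simp add: atLeast0LessThan)
qed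

text \<open>The expression is the distance of x ln x at \<open>l\<close> from its tangent at
  \<open>p\<close> (a Bregman divergence, the summand of relative entropy). For positive
  \<open>l\<close> it is \<open>l\<close> times the gap in ln t \<le> t - 1 at t = p / l; for
  \<open>l = 0\<close> it is \<open>p\<close>, which is positive.\<close>

lemma entropy_gap:
  fixes l p :: real
  assumes "0 \<le> l" "0 < p"
  shows "0 \<le> l * ln l - l * ln p - l + p" "l * ln l - l * ln p - l + p = 0 \<Longrightarrow> l = p"
proof -
  have "0 \<le> l * ln l - l * ln p - l + p \<and> (l * ln l - l * ln p - l + p = 0 \<longrightarrow> l = p)"
  proof (cases "l = 0")
    case False
    with assms have l: "0 < l" by simp
    have eq: "l * ln l - l * ln p - l + p = l * (p / l - 1 - ln (p / l))"
      using l assms by (simp add: ln_div field_simps)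
    have "ln (p / l) \<le> p / l - 1"
      using l assms by (intro ln_le_minus_one) simp
    then have "0 \<le> l * (p / l - 1 - ln (p / l))"
      using l by (intro mult_nonneg_nonneg) auto
    moreover have "l = p" if "l * (p / l - 1 - ln (p / l)) = 0"
    proof -
      have "ln (p / l) = p / l - 1" using that l by simp
      then have "p / l = 1" using l assms by (intro ln_eq_minus_one) auto
      then show ?thesis using l by simp
    qed
    ultimately show ?thesis unfolding eq by blast
  qed (use assms in auto)
  then show "0 \<le> l * ln l - l * ln p - l + p" "l * ln l - l * ln p - l + p = 0 \<Longrightarrow> l = p"
    by blast+
qed

text \<open>This is \<open>entropy_gap\<close> summed with the weights \<open>D i j\<close>. Rows with \<open>p i = 0\<close> are treated apart,
  because \<open>ln 0 = 0\<close> here.\<close>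

lemma entropy_doubly_stochastic:
  fixes l p :: "nat \<Rightarrow> real"
  assumes D: "doubly_stochastic n D" and l: "\<And>j. j < n \<Longrightarrow> 0 \<le> l j"
    and p: "\<And>i. i < n \<Longrightarrow> p i = (\<Sum>j<n. D i j * l j)"
  shows "(\<Sum>i<n. p i * ln (p i)) \<le> (\<Sum>j<n. l j * ln (l j))"
    and "(\<Sum>j<n. l j * ln (l j)) \<le> (\<Sum>i<n. p i * ln (p i)) \<Longrightarrow> i < n \<Longrightarrow> j < n \<Longrightarrow>
      D i j \<noteq> 0 \<Longrightarrow> l j = p i"
proof -
  have D0: "0 \<le> D i j" if "i < n" "j < n" for i j
    using D that by (simp add: doubly_stochastic_def)
  have p0: "0 \<le> p i" if "i < n" for i
    using that D0 l by (auto simp: p intro!: sum_nonneg)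
  define g where "g i j = D i j * (l j * ln (l j) - l j * ln (p i) - l j + p i)" for i j
  have g: "0 \<le> g i j \<and> (g i j = 0 \<longrightarrow> D i j \<noteq> 0 \<longrightarrow> l j = p i)" if ij: "i < n" "j < n" for i j
  proof (cases "p i = 0")
    case True
    then have "(\<Sum>j<n. D i j * l j) = 0" using p[OF ij(1)] by simp
    then have "D i j * l j = 0"
      using ij D0 l by (subst (asm) sum_nonneg_eq_0_iff) auto
    then show ?thesis using True by (auto simp: g_def)
  next
    case False
    then have "0 < p i" using p0[OF ij(1)] by simp
    from entropy_gap[OF l[OF ij(2)] this] D0[OF ij] show ?thesis by (auto simp: g_def)
  qed
  \<comment> \<open>The average of the \<open>l j\<close> along row \<open>i\<close> is
    \<open>p i\<close>, so the linear terms \<open>- l j + p i\<close> cancel and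
    \<open>ln (p i)\<close> receives the factor \<open>p i\<close>. What remains is row i's share of
    the entropy difference.\<close>
  have row: "(\<Sum>j<n. g i j) = (\<Sum>j<n. D i j * (l j * ln (l j))) - p i * ln (p i)" if i: "i < n" for i
  proof -
    have "(\<Sum>j<n. g i j) = (\<Sum>j<n. D i j * (l j * ln (l j)) - D i j * l j * ln (p i) - D i j * l j + D i j * p i)"
      by (simp add: g_def algebra_simps)
    also have "\<dots> = (\<Sum>j<n. D i j * (l j * ln (l j))) - (\<Sum>j<n. D i j * l j) * ln (p i)
        - (\<Sum>j<n. D i j * l j) + (\<Sum>j<n. D i j) * p i"
      by (simp add: sum.distrib sum_subtractf sum_distrib_right)
    finally show ?thesis using D i by (simp add: p doubly_stochastic_def)
  qed
  have "(\<Sum>i<n. \<Sum>j<n. g i j) = (\<Sum>i<n. \<Sum>j<n. D i j * (l j * ln (l j))) - (\<Sum>i<n. p i * ln (p i))"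
    by (simp add: row sum_subtractf)
  also have "(\<Sum>i<n. \<Sum>j<n. D i j * (l j * ln (l j))) = (\<Sum>j<n. l j * ln (l j))"
    using D by (subst sum.swap) (simp add: doubly_stochastic_def flip: sum_distrib_right)
  finally have total: "(\<Sum>i<n. \<Sum>j<n. g i j) = (\<Sum>j<n. l j * ln (l j)) - (\<Sum>i<n. p i * ln (p i))" .
  have "0 \<le> (\<Sum>i<n. \<Sum>j<n. g i j)"
    using g by (intro sum_nonneg) auto
  with total show le: "(\<Sum>i<n. p i * ln (p i)) \<le> (\<Sum>j<n. l j * ln (l j))" by simp
  show "l j = p i" if "(\<Sum>j<n. l j * ln (l j)) \<le> (\<Sum>i<n. p i * ln (p i))" "i < n" "j < n" "D i j \<noteq> 0"
  proof -
    have "(\<Sum>i<n. \<Sum>j<n. g i j) = 0" using total le that(1) by simp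
    then have "(\<Sum>j<n. g i j) = 0"
      using that(2) g by (subst (asm) sum_nonneg_eq_0_iff) (auto intro: sum_nonneg)
    then have "g i j = 0"
      using that(2,3) g by (subst (asm) sum_nonneg_eq_0_iff) auto
    then show ?thesis using g that by blast
  qed
qed

text \<open>\<open>p\<close> is the image of the spectrum \<open>l\<close> of \<rho> under the
  transition matrix from the eigenbasis \<open>U\<close> to \<open>V\<close>, which makes this an
  instance of \<open>entropy_doubly_stochastic\<close>. The last conjunct, the equality case, later
  turns maximality of the entropy into diagonality.\<close>

lemma entropy_dephasing:
  assumes \<rho>: "is_state n \<rho>" and V: "unitary_mat (2 ^ n) V"
  shows "\<exists>p. (\<forall>i<2 ^ n. 0 \<le> p i) \<and> (\<Sum>i<2 ^ n. p i) = 1 \<and>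
    (\<forall>i<2 ^ n. (adj V * \<rho> * V) $$ (i, i) = complex_of_real (p i)) \<and>
    von_neumann_entropy \<rho> \<le> - (\<Sum>i<2 ^ n. p i * ln (p i)) \<and>
    (- (\<Sum>i<2 ^ n. p i * ln (p i)) \<le> von_neumann_entropy \<rho> \<longrightarrow>
      adj V * \<rho> * V = mat_diag (2 ^ n) (\<lambda>i. complex_of_real (p i)))"
proof -
  obtain U l where U: "unitary_mat (2 ^ n) U"
    and \<rho>U: "\<rho> = U * mat_diag (2 ^ n) (\<lambda>i. complex_of_real (l i)) * adj U"
    and l: "\<And>i. i < 2 ^ n \<Longrightarrow> 0 \<le> l i" "(\<Sum>i<2 ^ n. l i) = 1"
    by (rule state_diagonalise[OF \<rho>]) blast
  define G where "G = adj V * U"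
  have G: "unitary_mat (2 ^ n) G"
    unfolding G_def by (intro unitary_mult unitary_adj U V)
  note Gc = unitary_carrier[OF G]
  have \<rho>G: "adj V * \<rho> * V = G * mat_diag (2 ^ n) (\<lambda>i. complex_of_real (l i)) * adj G"
    unfolding \<rho>U G_def
    using conj_conj[OF adj_carrier[OF unitary_carrier[OF V]] unitary_carrier[OF U] mat_diag_carrier]
    by simp
  define D where "D i j = (cmod (G $$ (i, j)))\<^sup>2" for i j
  have D: "doubly_stochastic (2 ^ n) D"
    unfolding D_def by (rule doubly_stochastic_unitary[OF G])
  define p where "p i = (\<Sum>j<2 ^ n. D i j * l j)" for i
  have diag: "(adj V * \<rho> * V) $$ (i, i) = complex_of_real (p i)" if "i < 2 ^ n" for i
    unfolding \<rho>G p_def D_def by (rule conj_diag_index_real[OF Gc that])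
  have S: "von_neumann_entropy \<rho> = - (\<Sum>i<2 ^ n. l i * ln (l i))"
    unfolding \<rho>U by (rule entropy_conj_diag[OF U])
  note ds = entropy_doubly_stochastic[where l = l and p = p, OF D l(1) p_def]
  show ?thesis
  proof (intro exI[of _ p] conjI allI impI)
    show "0 \<le> p i" if "i < 2 ^ n" for i
      using that l(1) by (auto simp: p_def D_def intro!: sum_nonneg)
    have "(\<Sum>i<2 ^ n. p i) = (\<Sum>j<2 ^ n. \<Sum>i<2 ^ n. D i j * l j)"
      unfolding p_def by (rule sum.swap)
    also have "\<dots> = (\<Sum>j<2 ^ n. l j)"
      using D by (simp add: doubly_stochastic_def flip: sum_distrib_right)
    finally show "(\<Sum>i<2 ^ n. p i) = 1" using l(2) by simp
    show "von_neumann_entropy \<rho> \<le> - (\<Sum>i<2 ^ n. p i * ln (p i))"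
      unfolding S using ds(1) by simp
    show "adj V * \<rho> * V = mat_diag (2 ^ n) (\<lambda>i. complex_of_real (p i))"
      if le: "- (\<Sum>i<2 ^ n. p i * ln (p i)) \<le> von_neumann_entropy \<rho>"
    proof (rule eq_matI)
      fix i k assume "i < dim_row (mat_diag (2 ^ n) (\<lambda>i. complex_of_real (p i)))"
        "k < dim_col (mat_diag (2 ^ n) (\<lambda>i. complex_of_real (p i)))"
      then have ik: "i < 2 ^ n" "k < 2 ^ n" by simp_all
      have eq: "l j = p i" if "j < 2 ^ n" "G $$ (i, j) \<noteq> 0" for j
      proof (rule ds(2))
        show "(\<Sum>j<2 ^ n. l j * ln (l j)) \<le> (\<Sum>i<2 ^ n. p i * ln (p i))"
          using le unfolding S by linarith
      qed (use that ik in \<open>simp_all add: D_def\<close>)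
      have "(adj V * \<rho> * V) $$ (i, k) = (\<Sum>j<2 ^ n. G $$ (i, j) * complex_of_real (l j) * cnj (G $$ (k, j)))"
        unfolding \<rho>G by (rule conj_diag_index[OF Gc ik])
      \<comment> \<open>In the equality case only eigenvalues equal to \<open>p i\<close> contribute
        to row \<open>i\<close>. So \<open>p i\<close> can be pulled out, and an entry of
        \<open>G * adj G\<close>, the identity, remains.\<close>
      also have "\<dots> = (\<Sum>j<2 ^ n. complex_of_real (p i) * (G $$ (i, j) * 1 * cnj (G $$ (k, j))))"
        by (intro sum.cong refl) (use eq in \<open>force simp: mult_ac\<close>)
      also have "\<dots> = complex_of_real (p i) * (G * mat_diag (2 ^ n) (\<lambda>_. 1) * adj G) $$ (i, k)"
        unfolding conj_diag_index[OF Gc ik] sum_distrib_left ..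
      also have "G * mat_diag (2 ^ n) (\<lambda>_. 1) * adj G = 1\<^sub>m (2 ^ n)"
        unfolding mat_diag_one right_mult_one_mat[OF Gc] by (rule unitary_right[OF G])
      finally show "(adj V * \<rho> * V) $$ (i, k) = mat_diag (2 ^ n) (\<lambda>i. complex_of_real (p i)) $$ (i, k)"
        using ik by (simp add: mat_diag_def)
    qed (use carrier_matD[OF unitary_carrier[OF V]] in simp_all)
  qed (fact diag)
qed

section \<open>Existence of entropy maximisers\<close>

lemma continuous_on_x_ln_x: "continuous_on {0..} (\<lambda>x :: real. x * ln x)"
proof -
  have "((\<lambda>x :: real. x * ln x) \<longlongrightarrow> 0) (at_right 0)" by real_asymp
  \<comment> \<open>The product \<open>0 * ln 0\<close> is 0 because of its first factor, so the
    value at 0 agrees with the limit.\<close>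
  then have "((\<lambda>x :: real. x * ln x) \<longlongrightarrow> 0 * ln 0) (at 0 within {0..})"
    by (simp add: at_within_Ici_at_right)
  moreover have "((\<lambda>x :: real. x * ln x) \<longlongrightarrow> x * ln x) (at x within {0..})" if "0 < x" for x
    using that by (intro tendsto_intros) auto
  ultimately show ?thesis
    unfolding continuous_on_def by (metis atLeast_iff less_eq_real_def)
qed

text \<open>\<open>feasible\<close> does not constrain the coordinates from \<open>N\<close> on.
  Resetting them to 0 preserves feasibility and entropy and puts the vector into a product of
  intervals and points, which is compact by Tychonoff. The constraints are closed and the entropy is
  continuous there, so a maximum is attained.\<close>

lemma entropy_attains_max:
  fixes s :: "nat \<Rightarrow> nat \<Rightarrow> complex" and c :: "nat \<Rightarrow> complex" and N n :: nat
    and feasible :: "(nat \<Rightarrow> real) \<Rightarrow> bool"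
  assumes feasible_def: "\<And>p. feasible p \<longleftrightarrow> (\<forall>i<N. 0 \<le> p i) \<and> (\<Sum>i<N. p i) = 1 \<and>
    (\<forall>k<n. (\<Sum>i<N. s k i * complex_of_real (p i)) = c k)"
    and "feasible q"
  shows "\<exists>p. feasible p \<and>
    (\<forall>p'. feasible p' \<longrightarrow> - (\<Sum>i<N. p' i * ln (p' i)) \<le> - (\<Sum>i<N. p i * ln (p i)))"
proof -
  define B where "B = (\<Pi>\<^sub>E i\<in>UNIV. if i < N then {0..1::real} else {0})"
  define K where "K = B \<inter> ({p. (\<Sum>i<N. p i) = 1} \<inter>
    (\<Inter>k\<in>{..<n}. {p. (\<Sum>i<N. s k i * complex_of_real (p i)) = c k}))"
  define F where "F p = - (\<Sum>i<N. p i * ln (p i))" for p :: "nat \<Rightarrow> real"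
  have "compactin (product_topology (\<lambda>_. euclidean) UNIV) B"
    unfolding B_def by (subst compactin_PiE) auto
  then have B: "compact B" by (simp add: euclidean_product_topology)
  have K: "compact K" unfolding K_def
    by (intro compact_Int_closed[OF B] closed_Int closed_INT ballI closed_Collect_eq continuous_intros
        continuous_on_product_coordinates)
  have restrict: "(\<lambda>i. if i < N then p i else 0) \<in> K" if "feasible p" for p
  proof -
    have "p i \<le> 1" if "i < N" for i
      using \<open>feasible p\<close> that member_le_sum[of i "{..<N}" p] by (auto simp: feasible_def)
    then show ?thesis
      using that by (auto simp: K_def B_def feasible_def PiE_iff)
  qed
  have nonneg: "0 \<le> p i" if "p \<in> K" "i < N" for p i
  proof -
    have "p i \<in> (if i < N then {0..1} else {0})" using \<open>p \<in> K\<close> unfolding K_def B_def by blast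
    then show ?thesis using that by simp
  qed
  have "continuous_on K (\<lambda>p. p i * ln (p i))" if "i < N" for i
    by (intro continuous_on_compose2[OF continuous_on_x_ln_x, of K "\<lambda>p. p i"]
        continuous_on_subset[OF continuous_on_product_coordinates]) (use nonneg that in auto)
  then have F: "continuous_on K F"
    unfolding F_def by (intro continuous_on_minus continuous_on_sum) auto
  obtain p where p: "p \<in> K" "\<And>p'. p' \<in> K \<Longrightarrow> F p' \<le> F p"
    using continuous_attains_sup[OF K _ F] restrict[OF assms(2)] by blast
  show ?thesis
  proof (intro exI[of _ p] conjI allI impI)
    show "feasible p" using p(1) nonneg unfolding feasible_def K_def by auto
    fix p' assume "feasible p'"
    from p(2)[OF restrict[OF this]]
    show "- (\<Sum>i<N. p' i * ln (p' i)) \<le> - (\<Sum>i<N. p i * ln (p i))" by (simp add: F_def)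
  qed
qed

subsection \<open>Simultaneous diagonalisation of commuting projections\<close>

lemma eigenvalues_finite:
  assumes "A \<in> carrier_mat n n"
  shows "finite {\<mu> :: complex. \<exists>v\<in>carrier_vec n. v \<noteq> 0\<^sub>v n \<and> A *\<^sub>v v = \<mu> \<cdot>\<^sub>v v}"
proof (rule finite_subset)
  show "{\<mu>. \<exists>v\<in>carrier_vec n. v \<noteq> 0\<^sub>v n \<and> A *\<^sub>v v = \<mu> \<cdot>\<^sub>v v} \<subseteq> {\<mu>. poly (char_poly A) \<mu> = 0}"
    using assms eigenvalue_root_char_poly[OF assms] by (auto simp: eigenvalue_def eigenvector_def)
  show "finite {\<mu>. poly (char_poly A) \<mu> = 0}"
    using degree_monic_char_poly[OF assms] by (intro poly_roots_finite) auto
qed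

lemma hermitian_add_smult:
  assumes "hermitian_mat n A" "hermitian_mat n P"
  shows "hermitian_mat n (A + complex_of_real c \<cdot>\<^sub>m P)"
proof -
  have c: "A \<in> carrier_mat n n" "P \<in> carrier_mat n n" "adj A = A" "adj P = P"
    using assms by (auto simp: hermitian_mat_def)
  have "adj (A + complex_of_real c \<cdot>\<^sub>m P) = adj A + complex_of_real c \<cdot>\<^sub>m adj P"
    using c(1,2) by (intro eq_matI) auto
  then show ?thesis using c by (simp add: hermitian_mat_def)
qed

lemma smult_mult_mat_vec:
  "A \<in> carrier_mat r m \<Longrightarrow> v \<in> carrier_vec m \<Longrightarrow> (c \<cdot>\<^sub>m A) *\<^sub>v v = c \<cdot>\<^sub>v (A *\<^sub>v (v :: complex vec))"
  by (intro eq_vecI) auto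

text \<open>If \<open>c\<close> is not a difference of two eigenvalues of \<open>A\<close>, then for every eigenvector \<open>v\<close> of
  \<open>A + c P\<close> one of the \<open>A\<close>-eigenvectors \<open>P v\<close> and \<open>v - P v\<close> vanishes.\<close>

lemma separating_hermitian:
  fixes P :: "nat \<Rightarrow> complex mat"
  assumes P: "\<And>k. k < m \<Longrightarrow> hermitian_mat n (P k)" "\<And>k. k < m \<Longrightarrow> P k * P k = P k"
    and comm: "\<And>k l. k < m \<Longrightarrow> l < m \<Longrightarrow> P k * P l = P l * P k"
    and "r \<le> m"
  shows "\<exists>A. hermitian_mat n A \<and> (\<forall>k<m. A * P k = P k * A) \<and>
    (\<forall>v\<in>carrier_vec n. \<forall>\<mu>. A *\<^sub>v v = \<mu> \<cdot>\<^sub>v v \<longrightarrow> (\<forall>k<r. \<exists>s. P k *\<^sub>v v = s \<cdot>\<^sub>v v))"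
  using \<open>r \<le> m\<close>
proof (induction r)
  case 0
  have "hermitian_mat n (0\<^sub>m n n)"
    by (auto simp: hermitian_mat_def intro!: eq_matI)
  moreover have "0\<^sub>m n n * P k = P k * 0\<^sub>m n n" if "k < m" for k
    using P(1)[OF that] left_mult_zero_mat[of "P k" n n n] right_mult_zero_mat[of "P k" n n n]
    by (simp add: hermitian_mat_def)
  ultimately show ?case by auto
next
  case (Suc r)
  then have r: "r < m" by simp
  from Suc obtain A where A: "hermitian_mat n A" "\<And>k. k < m \<Longrightarrow> A * P k = P k * A"
    and ev: "\<And>v \<mu> k. v \<in> carrier_vec n \<Longrightarrow> A *\<^sub>v v = \<mu> \<cdot>\<^sub>v v \<Longrightarrow> k < r \<Longrightarrow> \<exists>s. P k *\<^sub>v v = s \<cdot>\<^sub>v v"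
    by (metis Suc_leD)
  have Pc: "P k \<in> carrier_mat n n" if "k < m" for k
    using P(1)[OF that] by (simp add: hermitian_mat_def)
  have Ac: "A \<in> carrier_mat n n" using A(1) by (simp add: hermitian_mat_def)
  define E where "E = {\<mu>. \<exists>v\<in>carrier_vec n. v \<noteq> 0\<^sub>v n \<and> A *\<^sub>v v = \<mu> \<cdot>\<^sub>v v}"
  \<comment> \<open>\<open>c\<close> has to be real to keep \<open>B\<close> Hermitian, so it is
    enough to avoid the real parts of the differences of eigenvalues.\<close>
  have "finite ((\<lambda>(x, y). Re (x - y)) ` (E \<times> E))"
    unfolding E_def by (intro finite_imageI finite_cartesian_product eigenvalues_finite[OF Ac])
  then obtain c :: real where c: "c \<notin> (\<lambda>(x, y). Re (x - y)) ` (E \<times> E)"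
    using ex_new_if_finite[OF infinite_UNIV_char_0] by blast
  define B where "B = A + complex_of_real c \<cdot>\<^sub>m P r"
  have "hermitian_mat n B"
    unfolding B_def by (rule hermitian_add_smult[OF A(1) P(1)[OF r]])
  moreover have "B * P k = P k * B" if k: "k < m" for k
    unfolding B_def using Ac Pc[OF k] Pc[OF r] A(2)[OF k] comm[OF r k]
    by (simp add: add_mult_distrib_mat[of _ n n] mult_add_distrib_mat[of _ n n] mult_smult_distrib[of _ n n]
        mult_smult_assoc_mat[of _ n n])
  moreover have "\<exists>s. P k *\<^sub>v v = s \<cdot>\<^sub>v v"
    if v: "v \<in> carrier_vec n" and Bv: "B *\<^sub>v v = \<mu> \<cdot>\<^sub>v v" and k: "k < Suc r" for v \<mu> k
  proof -
    define u where "u = P r *\<^sub>v v"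
    have u: "u \<in> carrier_vec n" unfolding u_def by (rule mult_mat_vec_carrier[OF Pc[OF r] v])
    have Av: "A *\<^sub>v v \<in> carrier_vec n" by (rule mult_mat_vec_carrier[OF Ac v])
    have Au: "A *\<^sub>v u \<in> carrier_vec n" by (rule mult_mat_vec_carrier[OF Ac u])
    have B': "A *\<^sub>v v + complex_of_real c \<cdot>\<^sub>v u = \<mu> \<cdot>\<^sub>v v"
      using Bv unfolding B_def u_def add_mult_distrib_mat_vec[OF Ac smult_carrier_mat[OF Pc[OF r]] v]
        smult_mult_mat_vec[OF Pc[OF r] v] .
    have Pu: "P r *\<^sub>v u = u"
      unfolding u_def using assoc_mult_mat_vec[OF Pc[OF r] Pc[OF r] v] P(2)[OF r] by simp
    have PA: "P r *\<^sub>v (A *\<^sub>v v) = A *\<^sub>v u"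
      unfolding u_def using assoc_mult_mat_vec[OF Pc[OF r] Ac v] assoc_mult_mat_vec[OF Ac Pc[OF r] v] A(2)[OF r]
      by simp
    \<comment> \<open>\<open>P r\<close> is idempotent and commutes with \<open>A\<close>. Applying
      it to the eigenvalue equation of \<open>B\<close> gives \<open>A u = (\<mu> - c) u\<close>;
      subtracting this from the original equation gives \<open>A (v - u) = \<mu> (v - u)\<close>. By
      the choice of \<open>c\<close>, \<mu> and \<mu> - c cannot both be eigenvalues.\<close>
    have "P r *\<^sub>v (A *\<^sub>v v + complex_of_real c \<cdot>\<^sub>v u) = P r *\<^sub>v (\<mu> \<cdot>\<^sub>v v)" by (simp only: B')
    moreover have "complex_of_real c \<cdot>\<^sub>v u \<in> carrier_vec n" using u by simp
    ultimately have eq: "A *\<^sub>v u + complex_of_real c \<cdot>\<^sub>v u = \<mu> \<cdot>\<^sub>v u"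
      using mult_add_distrib_mat_vec[OF Pc[OF r] Av, of "complex_of_real c \<cdot>\<^sub>v u"]
      by (simp only: mult_mat_vec[OF Pc[OF r] v] mult_mat_vec[OF Pc[OF r] u] PA Pu u_def[symmetric])
    have Au_eq: "A *\<^sub>v u = (\<mu> - c) \<cdot>\<^sub>v u"
    proof (rule eq_vecI)
      fix i assume "i < dim_vec ((\<mu> - c) \<cdot>\<^sub>v u)"
      then have i: "i < n" using u by simp
      then have "(A *\<^sub>v u) $ i + c * u $ i = \<mu> * u $ i"
        using arg_cong[OF eq, of "\<lambda>w. w $ i"] u by simp
      then have "(A *\<^sub>v u) $ i = (\<mu> - c) * u $ i" by (simp add: algebra_simps)
      then show "(A *\<^sub>v u) $ i = ((\<mu> - c) \<cdot>\<^sub>v u) $ i" using i u by simp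
    qed (use Ac u in simp)
    have Av_eq: "A *\<^sub>v (v - u) = \<mu> \<cdot>\<^sub>v (v - u)"
      unfolding mult_minus_distrib_mat_vec[OF Ac v u] Au_eq
    proof (rule eq_vecI)
      fix i assume "i < dim_vec (\<mu> \<cdot>\<^sub>v (v - u))"
      then have i: "i < n" using u by simp
      then have "(A *\<^sub>v v) $ i + c * u $ i = \<mu> * v $ i"
        using arg_cong[OF B', of "\<lambda>w. w $ i"] u v by simp
      then have "(A *\<^sub>v v) $ i - (\<mu> - c) * u $ i = \<mu> * (v $ i - u $ i)" by (simp add: algebra_simps)
      then show "(A *\<^sub>v v - (\<mu> - c) \<cdot>\<^sub>v u) $ i = (\<mu> \<cdot>\<^sub>v (v - u)) $ i"
        using i u v Av by simp
    qed (use u v Ac in simp)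
    consider "u = 0\<^sub>v n" | "v - u = 0\<^sub>v n"
    proof -
      have False if "u \<noteq> 0\<^sub>v n" "v - u \<noteq> 0\<^sub>v n"
      proof -
        have "\<mu> - c \<in> E" unfolding E_def using Au_eq u that by blast
        moreover have "\<mu> \<in> E"
          unfolding E_def using Av_eq minus_carrier_vec[OF v u] that by blast
        ultimately have "(\<mu>, \<mu> - complex_of_real c) \<in> E \<times> E" by blast
        then have "(\<lambda>(x, y). Re (x - y)) (\<mu>, \<mu> - complex_of_real c) \<in> (\<lambda>(x, y). Re (x - y)) ` (E \<times> E)"
          by (rule imageI)
        with c show False by simp
      qed
      then show thesis using that by blast
    qed
    \<comment> \<open>In both cases \<open>A\<close> also maps \<open>v\<close> to a multiple of
      itself, so the induction hypothesis \<open>ev\<close> covers the operators before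
      \<open>P r\<close>.\<close>
    then have "(\<exists>s. P r *\<^sub>v v = s \<cdot>\<^sub>v v) \<and> (\<exists>\<mu>. A *\<^sub>v v = \<mu> \<cdot>\<^sub>v v)"
    proof cases
      case 1
      then have "P r *\<^sub>v v = 0 \<cdot>\<^sub>v v" using v by (auto simp: u_def[symmetric])
      moreover have "v - u = v" using 1 v by auto
      ultimately show ?thesis using Av_eq by metis
    next
      case 2
      have "u = v"
      proof (rule eq_vecI)
        fix i assume "i < dim_vec v"
        then show "u $ i = v $ i" using arg_cong[OF 2, of "\<lambda>w. w $ i"] u v by auto
      qed (use u v in auto)
      then have "P r *\<^sub>v v = 1 \<cdot>\<^sub>v v" by (simp add: u_def[symmetric])
      then show ?thesis using Au_eq \<open>u = v\<close> by blast
    qed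
    then show ?thesis using ev[OF v] k by (metis less_Suc_eq)
  qed
  ultimately show ?case by blast
qed

text \<open>Every eigenvector of the \<open>A\<close> from \<open>separating_hermitian\<close> is an
  eigenvector of all \<open>P k\<close>, whatever the multiplicity of its eigenvalue. So any
  orthonormal eigenbasis of \<open>A\<close> diagonalises all \<open>P k\<close> together.\<close>

lemma simultaneous_diagonalisation:
  fixes P :: "nat \<Rightarrow> complex mat"
  assumes P: "\<And>k. k < m \<Longrightarrow> hermitian_mat n (P k)" "\<And>k. k < m \<Longrightarrow> P k * P k = P k"
    and comm: "\<And>k l. k < m \<Longrightarrow> l < m \<Longrightarrow> P k * P l = P l * P k"
  shows "\<exists>V s. unitary_mat n V \<and> (\<forall>k<m. P k = V * mat_diag n (s k) * adj V)"
proof -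
  obtain A where A: "hermitian_mat n A"
    and ev: "\<And>v \<mu> k. v \<in> carrier_vec n \<Longrightarrow> A *\<^sub>v v = \<mu> \<cdot>\<^sub>v v \<Longrightarrow> k < m \<Longrightarrow> \<exists>s. P k *\<^sub>v v = s \<cdot>\<^sub>v v"
    using separating_hermitian[of m n P m, OF P comm order_refl] by blast
  obtain V p where V: "unitary_mat n V" and AV: "A = V * mat_diag n (\<lambda>i. complex_of_real (p i)) * adj V"
    using hermitian_diagonalise[OF A] by blast
  note Vc = unitary_carrier[OF V]
  have Ac: "A \<in> carrier_mat n n" using A by (simp add: hermitian_mat_def)
  have "A * V = V * mat_diag n (\<lambda>i. complex_of_real (p i))"
    unfolding AV using V by (simp add: sq_assoc[of _ n] unitary_left)
  then have col: "A *\<^sub>v col V j = complex_of_real (p j) \<cdot>\<^sub>v col V j" if "j < n" for j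
    using that Vc by (intro eq_vecI) (auto simp: col_mult2[OF Ac Vc that, symmetric] mat_diag_mult_right[of _ n n] mult.commute)
  have "\<exists>s. \<forall>j<n. P k *\<^sub>v col V j = s j \<cdot>\<^sub>v col V j" if k: "k < m" for k
  proof -
    have "\<exists>s. P k *\<^sub>v col V j = s \<cdot>\<^sub>v col V j" if "j < n" for j
      by (rule ev[OF _ col[OF that] k]) (use Vc that in auto)
    then show ?thesis by metis
  qed
  then obtain s where s: "\<And>k j. k < m \<Longrightarrow> j < n \<Longrightarrow> P k *\<^sub>v col V j = s k j \<cdot>\<^sub>v col V j"
    by metis
  show ?thesis
  proof (intro exI[of _ V] exI[of _ s] conjI V allI impI)
    fix k assume k: "k < m"
    have Pc: "P k \<in> carrier_mat n n" using P(1)[OF k] by (simp add: hermitian_mat_def)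
    have "P k * V = V * mat_diag n (s k)"
    proof (rule eq_matI)
      fix i j assume "i < dim_row (V * mat_diag n (s k))" "j < dim_col (V * mat_diag n (s k))"
      then have ij: "i < n" "j < n" using Vc by auto
      have "(P k * V) $$ (i, j) = (P k *\<^sub>v col V j) $ i" using ij Pc Vc by simp
      also have "\<dots> = (V * mat_diag n (s k)) $$ (i, j)"
        unfolding s[OF k ij(2)] using ij Vc by (simp add: mat_diag_mult_right[of _ n n])
      finally show "(P k * V) $$ (i, j) = (V * mat_diag n (s k)) $$ (i, j)" .
    qed (use Pc Vc in auto)
    then have "P k * V * adj V = V * mat_diag n (s k) * adj V" by simp
    then show "P k = V * mat_diag n (s k) * adj V"
      using Pc V by (simp add: sq_assoc[of _ n] unitary_right)
  qed
qed

subsection \<open>Fermionic operators\<close>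

lemma mat_zero_addD:
  assumes "A \<in> carrier_mat r c" "B \<in> carrier_mat r c" "A + B = 0\<^sub>m r c"
  shows "A = - (B :: complex mat)"
proof (rule eq_matI)
  fix i j assume "i < dim_row (- B)" "j < dim_col (- B)"
  then show "A $$ (i, j) = (- B) $$ (i, j)"
    using assms(1,2) arg_cong[OF assms(3), of "\<lambda>M. M $$ (i, j)"] by (auto simp: add_eq_0_iff2)
qed (use assms in auto)

lemma commute_product:
  assumes "X \<in> carrier_mat n n" "Y \<in> carrier_mat n n" "Z \<in> carrier_mat n n"
    and "X * Z = Z * X" "Y * Z = Z * (Y :: complex mat)"
  shows "(X * Y) * Z = Z * (X * Y)"
  unfolding sq_assoc[OF assms(1,2,3)] assms(5)
  unfolding sq_assoc[OF assms(1,3,2), symmetric] assms(4)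
  by (rule sq_assoc[OF assms(3,1,2)])

lemma anticommute_product:
  assumes "X \<in> carrier_mat n n" "Y \<in> carrier_mat n n" "Z \<in> carrier_mat n n"
    and XZ: "X * Z = - (Z * X)" and YZ: "Y * Z = - (Z * (Y :: complex mat))"
  shows "(X * Y) * Z = Z * (X * Y)"
proof -
  have "(X * Y) * Z = X * - (Z * Y)" unfolding sq_assoc[OF assms(1-3)] YZ ..
  also have "\<dots> = - (X * Z * Y)" using assms(1-3) by (simp add: sq_assoc[of _ n])
  also have "\<dots> = Z * (X * Y)" unfolding XZ using assms(1-3) by (simp add: sq_assoc[of _ n])
  finally show ?thesis .
qed

text \<open>The operators \<open>b\<close> are separate from the given \<open>a\<close>, because the
  locale is interpreted with the normal modes of the quenched Hamiltonian, which satisfy the same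
  relations.\<close>

locale fermions =
  fixes n :: nat and b :: "nat \<Rightarrow> complex mat"
  assumes fermion_ops: "fermion_ops n b"
begin

abbreviation dim where "dim \<equiv> (2 :: nat) ^ n"

abbreviation number_op :: "nat \<Rightarrow> complex mat" where
  "number_op k \<equiv> adj (b k) * b k"

lemma carrier [simp]: "k < n \<Longrightarrow> b k \<in> carrier_mat dim dim"
  using fermion_ops by (simp add: fermion_ops_def)

lemma number_op_carrier [simp]: "k < n \<Longrightarrow> number_op k \<in> carrier_mat dim dim"
  by simp

lemma car_mixed:
  "k < n \<Longrightarrow> l < n \<Longrightarrow> b k * adj (b l) + adj (b l) * b k = (if k = l then 1\<^sub>m dim else 0\<^sub>m dim dim)"
  and car_lower: "k < n \<Longrightarrow> l < n \<Longrightarrow> b k * b l + b l * b k = 0\<^sub>m dim dim"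
  and car_upper: "k < n \<Longrightarrow> l < n \<Longrightarrow> adj (b k) * adj (b l) + adj (b l) * adj (b k) = 0\<^sub>m dim dim"
  using fermion_ops by (simp_all add: fermion_ops_def anticommutator_def)

lemma anticommute:
  assumes "k < n" "l < n"
  shows "b k * b l = - (b l * b k)" "adj (b k) * adj (b l) = - (adj (b l) * adj (b k))"
    "k \<noteq> l \<Longrightarrow> b k * adj (b l) = - (adj (b l) * b k)"
    "k \<noteq> l \<Longrightarrow> adj (b k) * b l = - (b l * adj (b k))"
proof -
  show "b k * b l = - (b l * b k)"
    by (rule mat_zero_addD[OF _ _ car_lower]) (use assms in simp_all)
  show "adj (b k) * adj (b l) = - (adj (b l) * adj (b k))"
    by (rule mat_zero_addD[OF _ _ car_upper]) (use assms in simp_all)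
  show "b k * adj (b l) = - (adj (b l) * b k)" if "k \<noteq> l"
    by (rule mat_zero_addD[of _ dim dim]) (use assms that car_mixed[of k l] in simp_all)
  show "adj (b k) * b l = - (b l * adj (b k))" if "k \<noteq> l"
  proof (rule mat_zero_addD[of _ dim dim])
    have "adj (b k) * b l + b l * adj (b k) = b l * adj (b k) + adj (b k) * b l"
      by (rule comm_add_mat[of _ dim dim]) (use assms in simp_all)
    then show "adj (b k) * b l + b l * adj (b k) = 0\<^sub>m dim dim"
      using assms that by (simp add: car_mixed)
  qed (use assms in simp_all)
qed

lemma nilpotent:
  assumes "k < n"
  shows "b k * b k = 0\<^sub>m dim dim" "adj (b k) * adj (b k) = 0\<^sub>m dim dim"
proof -
  have "M = 0\<^sub>m dim dim" if M: "M \<in> carrier_mat dim dim" "M = - M" for M :: "complex mat"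
  proof (rule eq_matI)
    fix i j assume "i < dim_row (0\<^sub>m dim dim)" "j < dim_col (0\<^sub>m dim dim)"
    then show "M $$ (i, j) = 0\<^sub>m dim dim $$ (i, j)"
      using M(1) arg_cong[OF M(2), of "\<lambda>M. M $$ (i, j)"] by (auto simp: eq_neg_iff_add_eq_0)
  qed (use M in auto)
  from this[OF _ anticommute(1)] this[OF _ anticommute(2)] assms
  show "b k * b k = 0\<^sub>m dim dim" "adj (b k) * adj (b k) = 0\<^sub>m dim dim" by simp_all
qed

text \<open>Whatever \<open>adj (b k)\<close> produces has mode \<open>k\<close> occupied.
  Algebraically, multiply the relation \<open>b k * adj (b k) + adj (b k) * b k = 1\<close> by
  \<open>adj (b k)\<close> from the left; the second term contains a square of
  \<open>adj (b k)\<close> and vanishes. Idempotence of \<open>number_op k\<close> follows from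
  this.\<close>

lemma number_op_absorb:
  assumes k: "k < n"
  shows "number_op k * adj (b k) = adj (b k)"
proof -
  have c: "b k \<in> carrier_mat dim dim" "adj (b k) \<in> carrier_mat dim dim" using k by simp_all
  have "adj (b k) = adj (b k) * (b k * adj (b k) + adj (b k) * b k)"
    using k by (simp add: car_mixed right_mult_one_mat[OF c(2)])
  also have "\<dots> = adj (b k) * (b k * adj (b k)) + adj (b k) * (adj (b k) * b k)"
    by (rule mult_add_distrib_mat[OF c(2)]) (rule sq_mult_carrier[OF c] sq_mult_carrier[OF c(2,1)])+
  also have "adj (b k) * (adj (b k) * b k) = 0\<^sub>m dim dim"
    unfolding sq_assoc[OF c(2,2,1), symmetric] nilpotent(2)[OF k] by (rule left_mult_zero_mat[OF c(1)])
  finally show ?thesis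
    using c by (simp add: sq_assoc[of _ dim])
qed

lemma number_op_hermitian: "k < n \<Longrightarrow> hermitian_mat dim (number_op k)"
  by (simp add: hermitian_mat_def adj_mult[OF adj_carrier[OF carrier] carrier])

lemma number_op_idem:
  assumes k: "k < n"
  shows "number_op k * number_op k = number_op k"
proof -
  have "number_op k * number_op k = (number_op k * adj (b k)) * b k"
    using k by (simp add: sq_assoc[of _ dim])
  then show ?thesis using number_op_absorb[OF k] by simp
qed

lemma number_op_commute_mode:
  assumes "k < n" "l < n" "k \<noteq> l"
  shows "number_op k * b l = b l * number_op k" "number_op k * adj (b l) = adj (b l) * number_op k"
proof -
  have c: "adj (b k) \<in> carrier_mat dim dim" "b k \<in> carrier_mat dim dim"
    "b l \<in> carrier_mat dim dim" "adj (b l) \<in> carrier_mat dim dim"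
    using assms by simp_all
  show "number_op k * b l = b l * number_op k"
    by (rule anticommute_product[OF c(1-3) anticommute(4,1)]) (use assms in simp_all)
  show "number_op k * adj (b l) = adj (b l) * number_op k"
    by (rule anticommute_product[OF c(1,2,4) anticommute(2,3)]) (use assms in simp_all)
qed

lemma number_op_commute:
  assumes "k < n" "l < n"
  shows "number_op k * number_op l = number_op l * number_op k"
proof (cases "k = l")
  case False
  show ?thesis
    by (rule commute_product[OF adj_carrier[OF carrier] carrier number_op_carrier
          number_op_commute_mode(2)[symmetric] number_op_commute_mode(1)[symmetric], symmetric])
      (use assms False in simp_all)
qed simp

text \<open>The reason is that \<open>adj (b k) * b l\<close> raises the occupation of mode \<open>k\<close>.\<close>

lemma trace_hopping_zero:
  assumes kl: "k < n" "l < n" "k \<noteq> l" and \<rho>: "\<rho> \<in> carrier_mat dim dim"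
    and comm: "number_op k * \<rho> = \<rho> * number_op k"
  shows "tr (adj (b k) * b l * \<rho>) = 0"
proof -
  define X where "X = adj (b k) * b l"
  have X: "X \<in> carrier_mat dim dim" using kl by (simp add: X_def)
  note Nc = number_op_carrier[OF kl(1)]
  have NX: "number_op k * X = X"
    unfolding X_def using kl number_op_absorb[OF kl(1)]
    by (simp add: sq_assoc[of "number_op k" dim "adj (b k)" "b l", symmetric])
  have "X * number_op k = adj (b k) * (b l * number_op k)"
    unfolding X_def using kl by (simp add: sq_assoc[of _ dim])
  also have "\<dots> = adj (b k) * (number_op k * b l)"
    by (simp only: number_op_commute_mode[OF kl])
  also have "\<dots> = (adj (b k) * adj (b k)) * (b k * b l)"
    using kl by (simp add: sq_assoc[of _ dim])
  finally have XN: "X * number_op k = 0\<^sub>m dim dim"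
    unfolding nilpotent(2)[OF kl(1)] using kl by (simp add: left_mult_zero_mat[of _ dim])
  \<comment> \<open>With N the occupation operator of mode \<open>k\<close>, one has
    \<open>N * X = X\<close> and \<open>X * N = 0\<close>. Cyclicity of the trace moves N to the
    right, and commutation with \<rho> brings it next to \<open>X\<close>, where it annihilates the
    product.\<close>
  have "tr (X * \<rho>) = tr (number_op k * (X * \<rho>))"
    using NX sq_assoc[OF Nc X \<rho>] by simp
  also have "\<dots> = tr (X * \<rho> * number_op k)"
    by (rule tr_mult_comm[OF Nc sq_mult_carrier[OF X \<rho>]])
  also have "X * \<rho> * number_op k = X * number_op k * \<rho>"
    unfolding sq_assoc[OF X \<rho> Nc] sq_assoc[OF X Nc \<rho>] comm ..
  also have "\<dots> = 0\<^sub>m dim dim"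
    unfolding XN using \<rho> by simp
  finally show ?thesis by (simp add: X_def tr_def)
qed

lemma number_op_diagonalisation:
  "\<exists>V s. unitary_mat dim V \<and> (\<forall>k<n. number_op k = V * mat_diag dim (s k) * adj V)"
  by (rule simultaneous_diagonalisation[of n dim number_op,
        OF number_op_hermitian number_op_idem number_op_commute])

end

subsection \<open>Normal modes\<close>

lemma op_sum_carrier [simp]: "op_sum n f I \<in> carrier_mat (2 ^ n) (2 ^ n)"
  by (simp add: op_sum_def)

lemma op_sum_index: "r < 2 ^ n \<Longrightarrow> s < 2 ^ n \<Longrightarrow> op_sum n f I $$ (r, s) = (\<Sum>i\<in>I. f i $$ (r, s))"
  by (simp add: op_sum_def)

lemma adj_op_sum_smult:
  assumes "\<And>i. i \<in> I \<Longrightarrow> X i \<in> carrier_mat (2 ^ n) (2 ^ n)"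
  shows "adj (op_sum n (\<lambda>i. x i \<cdot>\<^sub>m X i) I) = op_sum n (\<lambda>i. cnj (x i) \<cdot>\<^sub>m adj (X i)) I"
proof (rule eq_matI)
  fix r s assume "r < dim_row (op_sum n (\<lambda>i. cnj (x i) \<cdot>\<^sub>m adj (X i)) I)"
    "s < dim_col (op_sum n (\<lambda>i. cnj (x i) \<cdot>\<^sub>m adj (X i)) I)"
  then have "r < 2 ^ n" "s < 2 ^ n" by (simp_all add: op_sum_def)
  then show "adj (op_sum n (\<lambda>i. x i \<cdot>\<^sub>m X i) I) $$ (r, s) = op_sum n (\<lambda>i. cnj (x i) \<cdot>\<^sub>m adj (X i)) I $$ (r, s)"
    using carrier_matD[OF assms] by (simp add: op_sum_def)
qed (simp_all add: op_sum_def)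

lemma op_sum_smult_mult:
  assumes X: "\<And>i. i \<in> I \<Longrightarrow> X i \<in> carrier_mat (2 ^ n) (2 ^ n)"
    and Y: "\<And>j. j \<in> J \<Longrightarrow> Y j \<in> carrier_mat (2 ^ n) (2 ^ n)"
  shows "op_sum n (\<lambda>i. x i \<cdot>\<^sub>m X i) I * op_sum n (\<lambda>j. y j \<cdot>\<^sub>m Y j) J =
    op_sum n (\<lambda>(i, j). (x i * y j) \<cdot>\<^sub>m (X i * Y j)) (I \<times> J)" (is "?L * ?R = ?S")
proof (rule eq_matI)
  fix r s assume "r < dim_row ?S" "s < dim_col ?S"
  then have rs: "r < 2 ^ n" "s < 2 ^ n" by (simp_all add: op_sum_def)
  have "(?L * ?R) $$ (r, s) = (\<Sum>t<2 ^ n. ?L $$ (r, t) * ?R $$ (t, s))"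
    by (rule mult_index[OF op_sum_carrier op_sum_carrier rs])
  also have "\<dots> = (\<Sum>t<2 ^ n. (\<Sum>i\<in>I. x i * X i $$ (r, t)) * (\<Sum>j\<in>J. y j * Y j $$ (t, s)))"
    using rs carrier_matD[OF X] carrier_matD[OF Y] by (intro sum.cong refl) (simp add: op_sum_index)
  also have "\<dots> = (\<Sum>t<2 ^ n. \<Sum>(i, j)\<in>I \<times> J. x i * y j * (X i $$ (r, t) * Y j $$ (t, s)))"
    unfolding sum_product sum.cartesian_product by (intro sum.cong refl) (auto simp: mult_ac)
  also have "\<dots> = (\<Sum>(i, j)\<in>I \<times> J. x i * y j * (\<Sum>t<2 ^ n. X i $$ (r, t) * Y j $$ (t, s)))"
    by (subst sum.swap) (simp add: sum_distrib_left case_prod_unfold)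
  also have "\<dots> = (\<Sum>(i, j)\<in>I \<times> J. x i * y j * (X i * Y j) $$ (r, s))"
    by (intro sum.cong refl) (auto simp: mult_index[OF X Y rs] simp del: index_mult_mat(1))
  also have "\<dots> = (\<Sum>(i, j)\<in>I \<times> J. ((x i * y j) \<cdot>\<^sub>m (X i * Y j)) $$ (r, s))"
    using rs carrier_matD[OF X] carrier_matD[OF Y] by (intro sum.cong refl) auto
  also have "\<dots> = ?S $$ (r, s)"
    using rs by (simp add: op_sum_index case_prod_unfold)
  finally show "(?L * ?R) $$ (r, s) = ?S $$ (r, s)" .
qed (simp_all add: op_sum_def)

lemma tr_op_sum_mult:
  assumes f: "\<And>i. i \<in> I \<Longrightarrow> f i \<in> carrier_mat (2 ^ n) (2 ^ n)" and \<rho>: "\<rho> \<in> carrier_mat (2 ^ n) (2 ^ n)"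
  shows "tr (op_sum n f I * \<rho>) = (\<Sum>i\<in>I. tr (f i * \<rho>))"
proof -
  have tr: "tr (M * \<rho>) = (\<Sum>r<2 ^ n. \<Sum>t<2 ^ n. M $$ (r, t) * \<rho> $$ (t, r))"
    if "M \<in> carrier_mat (2 ^ n) (2 ^ n)" for M
    using carrier_matD[OF that]
    by (auto simp: tr_def mult_index[OF that \<rho>] simp del: index_mult_mat(1))
  have "tr (op_sum n f I * \<rho>) = (\<Sum>r<2 ^ n. \<Sum>t<2 ^ n. \<Sum>i\<in>I. f i $$ (r, t) * \<rho> $$ (t, r))"
    unfolding tr[OF op_sum_carrier] by (simp add: op_sum_index sum_distrib_right)
  also have "\<dots> = (\<Sum>i\<in>I. \<Sum>r<2 ^ n. \<Sum>t<2 ^ n. f i $$ (r, t) * \<rho> $$ (t, r))"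
    by (subst sum.swap[of _ I]) (simp add: sum.swap[of _ I])
  also have "\<dots> = (\<Sum>i\<in>I. tr (f i * \<rho>))"
    by (intro sum.cong refl) (simp only: tr[OF f])
  finally show ?thesis .
qed

lemma tr_smult: "tr (c \<cdot>\<^sub>m M) = c * tr M"
  if "M \<in> carrier_mat m m" for M :: "complex mat"
  using that by (simp add: tr_def sum_distrib_left)

lemma tr_op_sum_smult:
  assumes "\<And>i. i \<in> I \<Longrightarrow> X i \<in> carrier_mat (2 ^ n) (2 ^ n)" and \<rho>: "\<rho> \<in> carrier_mat (2 ^ n) (2 ^ n)"
  shows "tr (op_sum n (\<lambda>i. x i \<cdot>\<^sub>m X i) I * \<rho>) = (\<Sum>i\<in>I. x i * tr (X i * \<rho>))"
proof -
  have "tr (op_sum n (\<lambda>i. x i \<cdot>\<^sub>m X i) I * \<rho>) = (\<Sum>i\<in>I. tr (x i \<cdot>\<^sub>m X i * \<rho>))"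
    by (rule tr_op_sum_mult[OF _ \<rho>]) (use assms in simp)
  also have "\<dots> = (\<Sum>i\<in>I. x i * tr (X i * \<rho>))"
    by (intro sum.cong refl)
      (simp only: mult_smult_assoc_mat[OF assms(1) \<rho>] tr_smult[OF sq_mult_carrier[OF assms(1) \<rho>]])
  finally show ?thesis .
qed

lemma fermion_ops_carrier: "fermion_ops n a \<Longrightarrow> i < n \<Longrightarrow> a i \<in> carrier_mat (2 ^ n) (2 ^ n)"
  by (simp add: fermion_ops_def)

lemma adj_normal_mode:
  assumes "fermion_ops n a"
  shows "adj (normal_mode n a A k) = op_sum n (\<lambda>j. A $$ (j, k) \<cdot>\<^sub>m adj (a j)) {..<n}"
  unfolding normal_mode_def using assms
  by (subst adj_op_sum_smult) (auto simp: fermion_ops_carrier)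

text \<open>Bilinearity leaves only the pairs with i = j. The parameter \<open>z\<close> covers all
  canonical relations at once: 1 for the mixed one, 0 for the two that vanish.\<close>

lemma anticommutator_op_sum:
  assumes X: "\<And>i. i < n \<Longrightarrow> X i \<in> carrier_mat (2 ^ n) (2 ^ n)"
    and Y: "\<And>j. j < n \<Longrightarrow> Y j \<in> carrier_mat (2 ^ n) (2 ^ n)"
    and XY: "\<And>i j. i < n \<Longrightarrow> j < n \<Longrightarrow>
      anticommutator (X i) (Y j) = (if i = j then z \<cdot>\<^sub>m 1\<^sub>m (2 ^ n) else 0\<^sub>m (2 ^ n) (2 ^ n))"
  shows "anticommutator (op_sum n (\<lambda>i. x i \<cdot>\<^sub>m X i) {..<n}) (op_sum n (\<lambda>j. y j \<cdot>\<^sub>m Y j) {..<n}) =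
    (z * (\<Sum>i<n. x i * y i)) \<cdot>\<^sub>m 1\<^sub>m (2 ^ n)" (is "anticommutator ?X ?Y = ?Z")
proof (rule eq_matI)
  fix r s assume "r < dim_row ?Z" "s < dim_col ?Z"
  then have rs: "r < 2 ^ n" "s < 2 ^ n" by simp_all
  have prodXY: "?X * ?Y = op_sum n (\<lambda>(i, j). (x i * y j) \<cdot>\<^sub>m (X i * Y j)) ({..<n} \<times> {..<n})"
    and prodYX: "?Y * ?X = op_sum n (\<lambda>(j, i). (y j * x i) \<cdot>\<^sub>m (Y j * X i)) ({..<n} \<times> {..<n})"
    by (rule op_sum_smult_mult; use X Y in simp)+
  have dims: "dim_row (X i) = 2 ^ n" "dim_col (X i) = 2 ^ n" "dim_row (Y i) = 2 ^ n" "dim_col (Y i) = 2 ^ n"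
    if "i < n" for i
    using X[OF that] Y[OF that] by auto
  have "anticommutator ?X ?Y $$ (r, s) = (?X * ?Y) $$ (r, s) + (?Y * ?X) $$ (r, s)"
    unfolding anticommutator_def by (rule index_add_mat(1)) (use rs in \<open>simp_all add: op_sum_def\<close>)
  also have "(?X * ?Y) $$ (r, s) = (\<Sum>i<n. \<Sum>j<n. x i * y j * (X i * Y j) $$ (r, s))"
    unfolding prodXY op_sum_index[OF rs] sum.cartesian_product
    using rs dims by (intro sum.cong refl) auto
  also have "(?Y * ?X) $$ (r, s) = (\<Sum>j<n. \<Sum>i<n. x i * y j * (Y j * X i) $$ (r, s))"
    unfolding prodYX op_sum_index[OF rs] sum.cartesian_product
    using rs dims by (intro sum.cong refl) auto
  also have "\<dots> = (\<Sum>i<n. \<Sum>j<n. x i * y j * (Y j * X i) $$ (r, s))"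
    by (rule sum.swap)
  also have "(\<Sum>i<n. \<Sum>j<n. x i * y j * (X i * Y j) $$ (r, s)) + \<dots> =
      (\<Sum>i<n. \<Sum>j<n. x i * y j * anticommutator (X i) (Y j) $$ (r, s))"
    unfolding sum.distrib[symmetric] anticommutator_def
    using rs dims by (intro sum.cong refl) (auto simp: distrib_left simp del: index_mult_mat(1))
  also have "\<dots> = (\<Sum>i<n. \<Sum>j<n. if i = j then x i * y j * (z \<cdot>\<^sub>m 1\<^sub>m (2 ^ n)) $$ (r, s) else 0)"
    using rs by (intro sum.cong refl) (auto simp: XY)
  also have "\<dots> = ?Z $$ (r, s)"
    using rs by (auto simp: sum_distrib_left mult_ac)
  finally show "anticommutator ?X ?Y $$ (r, s) = ?Z $$ (r, s)" .
qed (simp_all add: anticommutator_def op_sum_def)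

text \<open>A unitary mixing of modes preserves the relations: the mixed anticommutator of modes
  \<open>k\<close> and \<open>l\<close> is the (k, l) entry of \<open>adj A * A\<close> times the
  identity.\<close>

lemma fermion_ops_normal_mode:
  assumes a: "fermion_ops n a" and A: "unitary_mat n A"
  shows "fermion_ops n (normal_mode n a A)"
proof -
  have Ac: "A \<in> carrier_mat n n" using A by simp
  note c = fermion_ops_carrier[OF a] adj_carrier[OF fermion_ops_carrier[OF a]]
  have zero: "0 \<cdot>\<^sub>m 1\<^sub>m (2 ^ n) = (0\<^sub>m (2 ^ n) (2 ^ n) :: complex mat)"
    and one: "1 \<cdot>\<^sub>m 1\<^sub>m (2 ^ n) = (1\<^sub>m (2 ^ n) :: complex mat)"
    by (rule eq_matI; simp)+
  have orth: "(\<Sum>i<n. cnj (A $$ (i, k)) * A $$ (i, l)) = (if k = l then 1 else 0)" if "k < n" "l < n" for k l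
  proof -
    have "(\<Sum>i<n. cnj (A $$ (i, k)) * A $$ (i, l)) = (adj A * A) $$ (k, l)"
      using that Ac by (subst mult_index[OF adj_carrier[OF Ac] Ac]) auto
    then show ?thesis using that by (simp add: unitary_left[OF A])
  qed
  have "anticommutator (normal_mode n a A k) (adj (normal_mode n a A l)) =
      (if k = l then 1\<^sub>m (2 ^ n) else 0\<^sub>m (2 ^ n) (2 ^ n))" if "k < n" "l < n" for k l
    unfolding adj_normal_mode[OF a] unfolding normal_mode_def
    using a by (subst anticommutator_op_sum[of n a _ 1, OF c]) (auto simp: orth[OF that] zero one fermion_ops_def)
  moreover have "anticommutator (normal_mode n a A k) (normal_mode n a A l) = 0\<^sub>m (2 ^ n) (2 ^ n)" for k l
    unfolding normal_mode_def
    using a by (subst anticommutator_op_sum[of n a a 0, OF c(1,1)]) (auto simp: zero fermion_ops_def)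
  moreover have "anticommutator (adj (normal_mode n a A k)) (adj (normal_mode n a A l)) = 0\<^sub>m (2 ^ n) (2 ^ n)" for k l
    unfolding adj_normal_mode[OF a]
    using a by (subst anticommutator_op_sum[of n _ _ 0, OF c(2,2)]) (auto simp: zero fermion_ops_def)
  ultimately show ?thesis
    by (simp add: fermion_ops_def normal_mode_def)
qed

text \<open>Passing to normal modes turns a correlation matrix \<gamma> into \<open>A\<close>^T
  \<gamma> \<open>A\<close>^*, and \<open>A\<close>^T is \<open>adj (mat_cnj A)\<close>. In terms of
  the conjugate of \<open>A\<close> this is an ordinary unitary conjugation, to which the spectral
  lemmas apply.\<close>

abbreviation mat_cnj :: "complex mat \<Rightarrow> complex mat" where
  "mat_cnj \<equiv> map_mat cnj"

lemma mat_cnj_cnj [simp]: "mat_cnj (mat_cnj A) = A"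
  by (rule eq_matI) auto

lemma unitary_mat_cnj:
  assumes A: "unitary_mat n A"
  shows "unitary_mat n (mat_cnj A)"
proof (rule unitaryI)
  have Ac: "A \<in> carrier_mat n n" using A by simp
  then have Bc: "mat_cnj A \<in> carrier_mat n n" by simp
  show "mat_cnj A \<in> carrier_mat n n" by (rule Bc)
  show "adj (mat_cnj A) * mat_cnj A = 1\<^sub>m n"
  proof (rule eq_matI)
    fix i j assume "i < dim_row (1\<^sub>m n)" "j < dim_col (1\<^sub>m n)"
    then have ij: "i < n" "j < n" by auto
    have "(adj (mat_cnj A) * mat_cnj A) $$ (i, j) = cnj ((adj A * A) $$ (i, j))"
      unfolding mult_index[OF adj_carrier[OF Bc] Bc ij] mult_index[OF adj_carrier[OF Ac] Ac ij]
      using ij Ac by simp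
    then show "(adj (mat_cnj A) * mat_cnj A) $$ (i, j) = (1\<^sub>m n) $$ (i, j)"
      using ij by (simp add: unitary_left[OF A])
  qed (use Ac in simp_all)
qed

lemma correlation_carrier [simp]: "correlation_matrix n a \<rho> \<in> carrier_mat n n"
  by (simp add: correlation_matrix_def)

lemma conj_modes_index:
  assumes A: "A \<in> carrier_mat n n" and M: "M \<in> carrier_mat n n" and kl: "k < n" "l < n"
  shows "(adj (mat_cnj A) * M * mat_cnj A) $$ (k, l) = (\<Sum>i<n. \<Sum>j<n. A $$ (i, k) * cnj (A $$ (j, l)) * M $$ (i, j))"
proof -
  have B: "mat_cnj A \<in> carrier_mat n n" using A by simp
  have "(adj (mat_cnj A) * M * mat_cnj A) $$ (k, l) =
      (\<Sum>j<n. (adj (mat_cnj A) * M) $$ (k, j) * mat_cnj A $$ (j, l))"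
    by (rule mult_index[OF sq_mult_carrier[OF adj_carrier[OF B] M] B kl])
  also have "\<dots> = (\<Sum>j<n. \<Sum>i<n. A $$ (i, k) * cnj (A $$ (j, l)) * M $$ (i, j))"
    using A kl by (intro sum.cong refl)
      (auto simp: mult_index[OF adj_carrier[OF B] M kl(1)] sum_distrib_right sum_distrib_left mult_ac simp del: index_mult_mat(1))
  also have "\<dots> = (\<Sum>i<n. \<Sum>j<n. A $$ (i, k) * cnj (A $$ (j, l)) * M $$ (i, j))"
    by (rule sum.swap)
  finally show ?thesis .
qed

lemma correlation_normal_mode:
  assumes a: "fermion_ops n a" and A: "A \<in> carrier_mat n n" and \<rho>: "\<rho> \<in> carrier_mat (2 ^ n) (2 ^ n)"
  shows "correlation_matrix n (normal_mode n a A) \<rho> = adj (mat_cnj A) * correlation_matrix n a \<rho> * mat_cnj A"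
proof (rule eq_matI)
  fix k l assume "k < dim_row (adj (mat_cnj A) * correlation_matrix n a \<rho> * mat_cnj A)"
    "l < dim_col (adj (mat_cnj A) * correlation_matrix n a \<rho> * mat_cnj A)"
  then have kl: "k < n" "l < n" using A by auto
  note c = fermion_ops_carrier[OF a] adj_carrier[OF fermion_ops_carrier[OF a]]
  have "correlation_matrix n (normal_mode n a A) \<rho> $$ (k, l) =
      tr (op_sum n (\<lambda>(i, j). (A $$ (i, k) * cnj (A $$ (j, l))) \<cdot>\<^sub>m (adj (a i) * a j)) ({..<n} \<times> {..<n}) * \<rho>)"
  proof -
    have "adj (normal_mode n a A k) * normal_mode n a A l =
        op_sum n (\<lambda>(i, j). (A $$ (i, k) * cnj (A $$ (j, l))) \<cdot>\<^sub>m (adj (a i) * a j)) ({..<n} \<times> {..<n})"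
      unfolding adj_normal_mode[OF a] unfolding normal_mode_def
      by (rule op_sum_smult_mult) (use c in simp_all)
    then show ?thesis using kl by (simp add: correlation_matrix_def)
  qed
  also have "\<dots> = (\<Sum>(i, j)\<in>{..<n} \<times> {..<n}. A $$ (i, k) * cnj (A $$ (j, l)) * tr (adj (a i) * a j * \<rho>))"
    unfolding case_prod_unfold by (rule tr_op_sum_smult[OF _ \<rho>]) (auto simp: c)
  also have "\<dots> = (\<Sum>i<n. \<Sum>j<n. A $$ (i, k) * cnj (A $$ (j, l)) * correlation_matrix n a \<rho> $$ (i, j))"
    unfolding sum.cartesian_product by (intro sum.cong refl) (auto simp: correlation_matrix_def)
  also have "\<dots> = (adj (mat_cnj A) * correlation_matrix n a \<rho> * mat_cnj A) $$ (k, l)"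
    by (rule conj_modes_index[OF A correlation_carrier kl, symmetric])
  finally show "correlation_matrix n (normal_mode n a A) \<rho> $$ (k, l) =
    (adj (mat_cnj A) * correlation_matrix n a \<rho> * mat_cnj A) $$ (k, l)" .
qed (use A in \<open>simp_all add: correlation_matrix_def\<close>)

lemma energy_quadratic_hamiltonian:
  assumes a: "fermion_ops n a" and A: "A \<in> carrier_mat n n" and \<rho>: "\<rho> \<in> carrier_mat (2 ^ n) (2 ^ n)"
    and c: "c = A * mat_diag n (\<lambda>k. complex_of_real (\<epsilon> k)) * adj A"
  shows "energy \<rho> (quadratic_hamiltonian n a c) =
    (\<Sum>k<n. \<epsilon> k * Re ((adj (mat_cnj A) * correlation_matrix n a \<rho> * mat_cnj A) $$ (k, k)))"
proof -
  note ca = fermion_ops_carrier[OF a] adj_carrier[OF fermion_ops_carrier[OF a]]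
  let ?\<gamma> = "correlation_matrix n a \<rho>"
  have "tr (\<rho> * quadratic_hamiltonian n a c) = tr (quadratic_hamiltonian n a c * \<rho>)"
    unfolding quadratic_hamiltonian_def by (rule tr_mult_comm[OF \<rho> op_sum_carrier])
  also have "\<dots> = (\<Sum>(i, j)\<in>{..<n} \<times> {..<n}. c $$ (i, j) * tr (adj (a i) * a j * \<rho>))"
    unfolding quadratic_hamiltonian_def case_prod_unfold
    by (subst tr_op_sum_smult[OF _ \<rho>]) (auto simp: ca)
  also have "\<dots> = (\<Sum>i<n. \<Sum>j<n. c $$ (i, j) * ?\<gamma> $$ (i, j))"
    unfolding sum.cartesian_product by (intro sum.cong refl) (auto simp: correlation_matrix_def)
  also have "\<dots> = (\<Sum>i<n. \<Sum>j<n. \<Sum>k<n. \<epsilon> k * (A $$ (i, k) * cnj (A $$ (j, k)) * ?\<gamma> $$ (i, j)))"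
    unfolding c by (intro sum.cong refl) (simp add: conj_diag_index[OF A] sum_distrib_right sum_distrib_left mult_ac del: index_mult_mat(1))
  also have "\<dots> = (\<Sum>i<n. \<Sum>k<n. \<Sum>j<n. \<epsilon> k * (A $$ (i, k) * cnj (A $$ (j, k)) * ?\<gamma> $$ (i, j)))"
    by (intro sum.cong refl sum.swap)
  also have "\<dots> = (\<Sum>k<n. \<Sum>i<n. \<Sum>j<n. \<epsilon> k * (A $$ (i, k) * cnj (A $$ (j, k)) * ?\<gamma> $$ (i, j)))"
    by (rule sum.swap)
  also have "\<dots> = (\<Sum>k<n. \<epsilon> k * (adj (mat_cnj A) * ?\<gamma> * mat_cnj A) $$ (k, k))"
    by (intro sum.cong refl) (simp add: conj_modes_index[OF A correlation_carrier] sum_distrib_left del: index_mult_mat(1))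
  finally show ?thesis by (simp add: energy_def del: index_mult_mat(1))
qed

subsection \<open>Equilibration\<close>

lemma state_carrier: "is_state n \<rho> \<Longrightarrow> \<rho> \<in> carrier_mat (2 ^ n) (2 ^ n)"
  by (simp add: is_state_def hermitian_mat_def)

context fermions
begin

text \<open>In a basis that diagonalises the operator \<open>N\<close>, its expectation value sees
  only the diagonal of the state. Dephasing in that basis therefore preserves it.\<close>

lemma trace_number_op:
  assumes V: "unitary_mat dim V" and N: "N = V * mat_diag dim s * adj V" and \<rho>: "\<rho> \<in> carrier_mat dim dim"
  shows "tr (N * \<rho>) = (\<Sum>i<dim. s i * (adj V * \<rho> * V) $$ (i, i))"
proof -
  note Vc = unitary_carrier[OF V]
  have "tr (N * \<rho>) = tr (adj V * (N * \<rho>) * V)"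
    using tr_conj(2)[OF V, of "N * \<rho>"] \<rho> Vc by (simp add: N)
  also have "adj V * (N * \<rho>) * V = mat_diag dim s * (adj V * \<rho> * V)"
    unfolding N using V \<rho> by (simp add: sq_assoc[of _ dim] unitary_cancel)
  finally show ?thesis
    using Vc \<rho> by (simp add: tr_def mat_diag_mult_left[of _ dim dim] del: index_mult_mat(1))
qed

lemma tr_number_op_conj_diag:
  assumes V: "unitary_mat dim V" and N: "N = V * mat_diag dim s * adj V"
  shows "tr (N * (V * mat_diag dim f * adj V)) = (\<Sum>i<dim. s i * f i)"
  using V by (simp add: trace_number_op[OF V N] conj_cancel(1)[OF V] del: index_mult_mat(1))

lemma max_entropy_correlations:
  assumes \<omega>: "is_state n \<omega>"
    and max: "\<And>\<sigma>. is_state n \<sigma> \<Longrightarrow> (\<And>k. k < n \<Longrightarrow> tr (number_op k * \<sigma>) = tr (number_op k * \<omega>)) \<Longrightarrow>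
      von_neumann_entropy \<sigma> \<le> von_neumann_entropy \<omega>"
    and kl: "k < n" "l < n" "k \<noteq> l"
  shows "tr (adj (b k) * b l * \<omega>) = 0"
proof -
  obtain V s where V: "unitary_mat dim V" and N: "\<And>k. k < n \<Longrightarrow> number_op k = V * mat_diag dim (s k) * adj V"
    using number_op_diagonalisation by blast
  obtain p where p: "\<And>i. i < dim \<Longrightarrow> 0 \<le> p i" "(\<Sum>i<dim. p i) = 1"
    and diag: "\<And>i. i < dim \<Longrightarrow> (adj V * \<omega> * V) $$ (i, i) = complex_of_real (p i)"
    and "von_neumann_entropy \<omega> \<le> - (\<Sum>i<dim. p i * ln (p i))"
    and eq: "- (\<Sum>i<dim. p i * ln (p i)) \<le> von_neumann_entropy \<omega> \<Longrightarrow>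
      adj V * \<omega> * V = mat_diag dim (\<lambda>i. complex_of_real (p i))"
    using entropy_dephasing[OF \<omega> V] by blast
  let ?D = "mat_diag dim (\<lambda>i. complex_of_real (p i))"
  have "is_state n (V * ?D * adj V)"
    unfolding is_state_conj_diag[OF V] using p by blast
  \<comment> \<open>The dephased state has the occupations of \<omega>, hence it is a competitor.
    Its entropy is at most that of \<omega>, which is the premise of the equality case
    \<open>eq\<close>.\<close>
  then have "von_neumann_entropy (V * ?D * adj V) \<le> von_neumann_entropy \<omega>"
  proof (rule max)
    fix k assume k: "k < n"
    show "tr (number_op k * (V * ?D * adj V)) = tr (number_op k * \<omega>)"
      unfolding tr_number_op_conj_diag[OF V N[OF k]] trace_number_op[OF V N[OF k] state_carrier[OF \<omega>]]
      by (intro sum.cong refl) (simp only: diag lessThan_iff)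
  qed
  then have D: "adj V * \<omega> * V = ?D"
    unfolding entropy_conj_diag[OF V] by (rule eq)
  have \<omega>V: "\<omega> = V * ?D * adj V"
    using conj_cancel(2)[OF V state_carrier[OF \<omega>], symmetric] unfolding D .
  have "number_op k * \<omega> = \<omega> * number_op k"
    unfolding N[OF kl(1)] \<omega>V conj_mult[OF V mat_diag_carrier mat_diag_carrier] mat_diag_diag
    by (simp only: mult.commute)
  then show ?thesis by (rule trace_hopping_zero[OF kl state_carrier[OF \<omega>]])
qed

text \<open>Dephasing in the joint eigenbasis keeps the occupations and does not lower the entropy,
  so every competitor is dominated by a diagonal one. The problem becomes a maximisation over
  probability vectors under linear constraints, and the dephased \<rho> shows that these can be
  satisfied.\<close>

lemma max_entropy_exists:
  assumes \<rho>: "is_state n \<rho>"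
  shows "\<exists>\<omega>. is_state n \<omega> \<and> (\<forall>k<n. tr (number_op k * \<omega>) = tr (number_op k * \<rho>)) \<and>
    (\<forall>\<sigma>. is_state n \<sigma> \<and> (\<forall>k<n. tr (number_op k * \<sigma>) = tr (number_op k * \<rho>)) \<longrightarrow>
      von_neumann_entropy \<sigma> \<le> von_neumann_entropy \<omega>)"
proof -
  obtain V s where V: "unitary_mat dim V" and N: "\<And>k. k < n \<Longrightarrow> number_op k = V * mat_diag dim (s k) * adj V"
    using number_op_diagonalisation by blast
  define feasible where "feasible p \<longleftrightarrow> (\<forall>i<dim. 0 \<le> p i) \<and> (\<Sum>i<dim. p i) = 1 \<and>
    (\<forall>k<n. (\<Sum>i<dim. s k i * complex_of_real (p i)) = tr (number_op k * \<rho>))" for p :: "nat \<Rightarrow> real"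
  have dephase: "\<exists>p. feasible p \<and> von_neumann_entropy \<sigma> \<le> - (\<Sum>i<dim. p i * ln (p i))"
    if \<sigma>: "is_state n \<sigma>" "\<forall>k<n. tr (number_op k * \<sigma>) = tr (number_op k * \<rho>)" for \<sigma>
  proof -
    obtain p where p: "\<And>i. i < dim \<Longrightarrow> 0 \<le> p i" "(\<Sum>i<dim. p i) = 1"
      and diag: "\<And>i. i < dim \<Longrightarrow> (adj V * \<sigma> * V) $$ (i, i) = complex_of_real (p i)"
      and S: "von_neumann_entropy \<sigma> \<le> - (\<Sum>i<dim. p i * ln (p i))"
      using entropy_dephasing[OF \<sigma>(1) V] by blast
    have "(\<Sum>i<dim. s k i * complex_of_real (p i)) = tr (number_op k * \<rho>)" if k: "k < n" for k
      unfolding \<sigma>(2)[rule_format, OF k, symmetric] trace_number_op[OF V N[OF k] state_carrier[OF \<sigma>(1)]]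
      by (intro sum.cong refl) (simp only: diag lessThan_iff)
    then have "feasible p" using p by (simp add: feasible_def)
    with S show ?thesis by blast
  qed
  obtain q where "feasible q" using dephase[OF \<rho>] by blast
  then obtain p where p: "feasible p"
    and max: "\<And>p'. feasible p' \<Longrightarrow> - (\<Sum>i<dim. p' i * ln (p' i)) \<le> - (\<Sum>i<dim. p i * ln (p i))"
    using entropy_attains_max[OF feasible_def] by blast
  let ?\<omega> = "V * mat_diag dim (\<lambda>i. complex_of_real (p i)) * adj V"
  have "is_state n ?\<omega>"
    unfolding is_state_conj_diag[OF V] using p by (simp add: feasible_def)
  moreover have "tr (number_op k * ?\<omega>) = tr (number_op k * \<rho>)" if k: "k < n" for k
    unfolding tr_number_op_conj_diag[OF V N[OF k]] using p k by (simp add: feasible_def)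
  moreover have "von_neumann_entropy \<sigma> \<le> von_neumann_entropy ?\<omega>"
    if "is_state n \<sigma>" "\<forall>k<n. tr (number_op k * \<sigma>) = tr (number_op k * \<rho>)" for \<sigma>
    unfolding entropy_conj_diag[OF V] using dephase[OF that] max by (meson order_trans)
  ultimately show ?thesis by blast
qed

end

lemma gge_state_exists:
  assumes "fermion_ops n a" "unitary_mat n A" "is_state n \<rho>"
  shows "\<exists>\<omega>. gge_state n a A \<rho> \<omega>"
proof -
  interpret fermions n "normal_mode n a A"
    by standard (rule fermion_ops_normal_mode[OF assms(1,2)])
  show ?thesis
    using max_entropy_exists[OF assms(3)] unfolding gge_state_def occupation_def .
qed

lemma occupation_correlation:
  "k < n \<Longrightarrow> occupation n a A k \<rho> = correlation_matrix n (normal_mode n a A) \<rho> $$ (k, k)"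
  by (simp add: occupation_def correlation_matrix_def)

text \<open>One equilibration as an update of eigenbasis and eigenvalue list: the basis
  \<open>V\<close> is replaced by \<open>mat_cnj A\<close>, and \<open>p\<close> by its image under
  the transition probabilities from \<open>V\<close> to the new basis. These images are the
  occupations, which the GGE state shares with \<rho>; its off-diagonal correlations between normal
  modes vanish by \<open>max_entropy_correlations\<close>.\<close>

lemma gge_state_correlation:
  assumes a: "fermion_ops n a" and A: "unitary_mat n A" and gge: "gge_state n a A \<rho> \<omega>"
    and \<rho>: "is_state n \<rho>" and V: "unitary_mat n V"
    and corr: "correlation_matrix n a \<rho> = V * mat_diag n (\<lambda>i. complex_of_real (p i)) * adj V"
  shows "correlation_matrix n a \<omega> = mat_cnj A *
    mat_diag n (\<lambda>k. complex_of_real (\<Sum>j<n. (cmod ((adj (mat_cnj A) * V) $$ (k, j)))\<^sup>2 * p j)) * adj (mat_cnj A)"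
proof -
  let ?W = "mat_cnj A"
  define G where "G = adj ?W * V"
  define q where "q k = (\<Sum>j<n. (cmod (G $$ (k, j)))\<^sup>2 * p j)" for k
  note Ac = unitary_carrier[OF A]
  have W: "unitary_mat n ?W" by (rule unitary_mat_cnj[OF A])
  note Wc = unitary_carrier[OF W] and Vc = unitary_carrier[OF V]
  have Gc: "G \<in> carrier_mat n n" unfolding G_def using Wc Vc by simp
  have \<omega>: "is_state n \<omega>" using gge unfolding gge_state_def by blast
  interpret fermions n "normal_mode n a A"
    by standard (rule fermion_ops_normal_mode[OF a A])
  have off: "correlation_matrix n (normal_mode n a A) \<omega> $$ (k, l) = 0" if "k < n" "l < n" "k \<noteq> l" for k l
  proof -
    have "tr (adj (normal_mode n a A k) * normal_mode n a A l * \<omega>) = 0"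
    proof (rule max_entropy_correlations[OF \<omega> _ that])
      fix \<sigma> assume "is_state n \<sigma>" and "\<And>k. k < n \<Longrightarrow> tr (number_op k * \<sigma>) = tr (number_op k * \<omega>)"
      then have "is_state n \<sigma> \<and> (\<forall>k<n. occupation n a A k \<sigma> = occupation n a A k \<rho>)"
        using gge unfolding gge_state_def occupation_def by metis
      then show "von_neumann_entropy \<sigma> \<le> von_neumann_entropy \<omega>"
        using gge unfolding gge_state_def by blast
    qed
    then show ?thesis using that by (simp add: correlation_matrix_def)
  qed
  have "correlation_matrix n (normal_mode n a A) \<rho> = G * mat_diag n (\<lambda>i. complex_of_real (p i)) * adj G"
    unfolding correlation_normal_mode[OF a Ac state_carrier[OF \<rho>]] corr G_def
    using conj_conj[OF adj_carrier[OF Wc] Vc mat_diag_carrier] unfolding adj_adj .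
  note corr\<rho> = this
  have diag: "correlation_matrix n (normal_mode n a A) \<omega> $$ (k, k) = complex_of_real (q k)" if k: "k < n" for k
  proof -
    have "occupation n a A k \<omega> = occupation n a A k \<rho>"
      using gge k unfolding gge_state_def by blast
    then show ?thesis
      unfolding occupation_correlation[OF k] corr\<rho> conj_diag_index_real[OF Gc k] q_def .
  qed
  have "correlation_matrix n (normal_mode n a A) \<omega> = mat_diag n (\<lambda>k. complex_of_real (q k))"
  proof (rule eq_matI)
    fix k l assume "k < dim_row (mat_diag n (\<lambda>k. complex_of_real (q k)))"
      "l < dim_col (mat_diag n (\<lambda>k. complex_of_real (q k)))"
    then have kl: "k < n" "l < n" by simp_all
    show "correlation_matrix n (normal_mode n a A) \<omega> $$ (k, l) = mat_diag n (\<lambda>k. complex_of_real (q k)) $$ (k, l)"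
      using off[OF kl] diag[OF kl(1)] kl by (cases "k = l") (simp_all add: mat_diag_def)
  qed (simp_all add: correlation_matrix_def)
  then have eq: "adj ?W * correlation_matrix n a \<omega> * ?W = mat_diag n (\<lambda>k. complex_of_real (q k))"
    by (simp only: correlation_normal_mode[OF a Ac state_carrier[OF \<omega>]])
  have "correlation_matrix n a \<omega> = ?W * mat_diag n (\<lambda>k. complex_of_real (q k)) * adj ?W"
    using conj_cancel(2)[OF W correlation_carrier[of n a \<omega>], symmetric] unfolding eq .
  then show ?thesis unfolding q_def G_def .
qed

subsection \<open>The lower bound\<close>

text \<open>The eigenvalues may be listed in any order \<open>ys\<close>. This is what allows one
  eigenbasis with increasing energies and another with decreasing occupations.\<close>

lemma hermitian_spectral_real:
  assumes M: "hermitian_mat n M" and ev: "real_eigenvalues M xs" and ys: "mset ys = mset xs"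
  shows "\<exists>W. unitary_mat n W \<and> M = W * mat_diag n (\<lambda>i. complex_of_real (ys ! i)) * adj W"
    and "length ys = n"
proof -
  have Mc: "M \<in> carrier_mat n n" using M by (simp add: hermitian_mat_def)
  have "(\<Prod>e\<leftarrow>map complex_of_real ys. [:- e, 1:]) = (\<Prod>e\<leftarrow>map complex_of_real xs. [:- e, 1:])"
    by (simp only: prod_mset_prod_list[symmetric] mset_map ys)
  then have cp: "char_poly M = (\<Prod>e\<leftarrow>map complex_of_real ys. [:- e, 1:])"
    using ev unfolding real_eigenvalues_def map_map o_def by (rule trans[OF _ sym, rotated])
  then have "degree (char_poly M) = length ys"
    using degree_linear_factors[of uminus "map complex_of_real ys"] by simp
  then show len: "length ys = n" using degree_monic_char_poly[OF Mc] by simp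
  obtain W where W: "unitary_mat n W" "M = W * mat_diag n (\<lambda>i. map complex_of_real ys ! i) * adj W"
    using hermitian_spectral[OF M cp] by blast
  moreover have "mat_diag n (\<lambda>i. map complex_of_real ys ! i) = mat_diag n (\<lambda>i. complex_of_real (ys ! i))"
    using len by (intro mat_diag_cong) simp
  ultimately show "\<exists>W. unitary_mat n W \<and> M = W * mat_diag n (\<lambda>i. complex_of_real (ys ! i)) * adj W"
    by metis
qed

lemma tr_adj: "M \<in> carrier_mat m m \<Longrightarrow> tr (adj M) = cnj (tr M)"
  by (simp add: tr_def)

lemma hermitian_correlation:
  assumes a: "fermion_ops n a" and \<rho>: "is_state n \<rho>"
  shows "hermitian_mat n (correlation_matrix n a \<rho>)"
  unfolding hermitian_mat_def
proof (intro conjI eq_matI)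
  have \<rho>c: "\<rho> \<in> carrier_mat (2 ^ n) (2 ^ n)" and \<rho>h: "adj \<rho> = \<rho>"
    using \<rho> by (simp_all add: is_state_def hermitian_mat_def)
  fix i j assume "i < dim_row (correlation_matrix n a \<rho>)" "j < dim_col (correlation_matrix n a \<rho>)"
  then have ij: "i < n" "j < n" by (simp_all add: correlation_matrix_def)
  note c = fermion_ops_carrier[OF a ij(1)] fermion_ops_carrier[OF a ij(2)]
  have cc: "adj (a i) * a j \<in> carrier_mat (2 ^ n) (2 ^ n)" "adj (a j) * a i \<in> carrier_mat (2 ^ n) (2 ^ n)"
    using c by simp_all
  have "cnj (tr (adj (a j) * a i * \<rho>)) = tr (adj (adj (a j) * a i * \<rho>))"
    by (rule tr_adj[OF sq_mult_carrier[OF cc(2) \<rho>c], symmetric])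
  also have "adj (adj (a j) * a i * \<rho>) = \<rho> * (adj (a i) * a j)"
    unfolding adj_mult[OF cc(2) \<rho>c] adj_mult[OF adj_carrier[OF c(2)] c(1)] \<rho>h adj_adj ..
  also have "tr \<dots> = tr (adj (a i) * a j * \<rho>)"
    by (rule tr_mult_comm[OF \<rho>c cc(1)])
  finally show "adj (correlation_matrix n a \<rho>) $$ (i, j) = correlation_matrix n a \<rho> $$ (i, j)"
    using ij by (simp add: correlation_matrix_def)
qed (simp_all add: correlation_matrix_def)

lemma energy_conj_diag:
  assumes a: "fermion_ops n a" and \<omega>: "is_state n \<omega>" and A: "unitary_mat n A"
    and c: "c = A * mat_diag n (\<lambda>k. complex_of_real (\<epsilon> k)) * adj A" and V: "unitary_mat n V"
    and corr: "correlation_matrix n a \<omega> = V * mat_diag n (\<lambda>i. complex_of_real (p i)) * adj V"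
  shows "energy \<omega> (quadratic_hamiltonian n a c) =
    (\<Sum>k<n. \<epsilon> k * (\<Sum>j<n. (cmod ((adj (mat_cnj A) * V) $$ (k, j)))\<^sup>2 * p j))"
proof -
  note W = unitary_carrier[OF unitary_mat_cnj[OF A]] and Vc = unitary_carrier[OF V]
  have "adj (mat_cnj A) * correlation_matrix n a \<omega> * mat_cnj A =
      (adj (mat_cnj A) * V) * mat_diag n (\<lambda>i. complex_of_real (p i)) * adj (adj (mat_cnj A) * V)"
    unfolding corr using conj_conj[OF adj_carrier[OF W] Vc mat_diag_carrier] unfolding adj_adj .
  note * = energy_quadratic_hamiltonian[OF a unitary_carrier[OF A] state_carrier[OF \<omega>] c, unfolded this]
  show ?thesis unfolding *
    by (intro sum.cong refl)
      (simp add: conj_diag_index_real[OF sq_mult_carrier[OF adj_carrier[OF W] Vc]] del: index_mult_mat(1) of_real_sum)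
qed

text \<open>The invariant of the protocol: \<open>V\<close> is the current eigenbasis of the
  correlation matrix and \<open>D\<close> the accumulated product of transition matrices, starting
  from the identity.\<close>

lemma gge_protocol_correlation:
  assumes a: "fermion_ops n a" and \<rho>0: "is_state n \<rho>0" and prot: "gge_protocol n a c0 \<rho>0 N c A \<omega>"
    and V0: "unitary_mat n V0"
    and corr0: "correlation_matrix n a \<rho>0 = V0 * mat_diag n (\<lambda>i. complex_of_real (d i)) * adj V0"
    and "m \<le> N"
  shows "is_state n (\<omega> m) \<and> (\<exists>V D. unitary_mat n V \<and> doubly_stochastic n D \<and>
    correlation_matrix n a (\<omega> m) = V * mat_diag n (\<lambda>i. complex_of_real (\<Sum>j<n. D i j * d j)) * adj V)"
  using \<open>m \<le> N\<close>
proof (induction m)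
  case 0
  have ds: "doubly_stochastic n (\<lambda>i j. if i = j then 1 else 0)"
    by (simp add: doubly_stochastic_def)
  have eq: "mat_diag n (\<lambda>i. complex_of_real (d i)) =
      mat_diag n (\<lambda>i. complex_of_real (\<Sum>j<n. (if i = j then 1 else 0) * d j))"
    by (intro mat_diag_cong) (simp add: if_distrib[of "\<lambda>x. x * _"] cong: if_cong)
  have "\<omega> 0 = \<rho>0" using prot unfolding gge_protocol_def by blast
  then show ?case
    using \<rho>0 V0 ds corr0[unfolded eq] by blast
next
  case (Suc m)
  then have "m \<le> N" by simp
  from Suc.IH[OF this] obtain V D where IH: "is_state n (\<omega> m)" "unitary_mat n V" "doubly_stochastic n D"
    "correlation_matrix n a (\<omega> m) = V * mat_diag n (\<lambda>i. complex_of_real (\<Sum>j<n. D i j * d j)) * adj V"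
    by blast
  have "Suc m \<in> {1..N}" using Suc.prems by simp
  then have "diagonalises n (A (Suc m)) (c (Suc m))" "gge_state n a (A (Suc m)) (\<omega> (Suc m - 1)) (\<omega> (Suc m))"
    using prot unfolding gge_protocol_def by blast+
  then have A: "unitary_mat n (A (Suc m))" and gge: "gge_state n a (A (Suc m)) (\<omega> m) (\<omega> (Suc m))"
    by (simp_all add: diagonalises_def)
  let ?W = "mat_cnj (A (Suc m))"
  define G where "G = adj ?W * V"
  have W: "unitary_mat n ?W" by (rule unitary_mat_cnj[OF A])
  have G: "unitary_mat n G" unfolding G_def by (rule unitary_mult[OF unitary_adj[OF W] IH(2)])
  define E where "E i j = (\<Sum>k<n. (cmod (G $$ (i, k)))\<^sup>2 * D k j)" for i j
  have E: "doubly_stochastic n E"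
    unfolding E_def by (rule doubly_stochastic_mult[OF doubly_stochastic_unitary[OF G] IH(3)])
  have "(\<Sum>k<n. (cmod (G $$ (i, k)))\<^sup>2 * (\<Sum>j<n. D k j * d j)) = (\<Sum>j<n. E i j * d j)" for i
    unfolding E_def sum_distrib_left sum_distrib_right by (subst sum.swap) (simp add: mult_ac)
  then have "correlation_matrix n a (\<omega> (Suc m)) =
      ?W * mat_diag n (\<lambda>i. complex_of_real (\<Sum>j<n. E i j * d j)) * adj ?W"
    using gge_state_correlation[OF a A gge IH(1,2,4)] unfolding G_def by (simp only:)
  moreover have "is_state n (\<omega> (Suc m))" using gge unfolding gge_state_def by blast
  ultimately show ?case using W E by blast
qed

text \<open>Evaluating the energy in an eigenbasis \<open>A0\<close> of \<open>c0\<close> with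
  increasing eigenvalues contributes one more transition matrix. So a single doubly stochastic
  \<open>E\<close> takes the decreasingly ordered initial eigenvalues to the final occupations of
  the modes given by \<open>A0\<close>, and the rearrangement inequality applies to it.\<close>

lemma gge_protocol_energy_bound:
  assumes a: "fermion_ops n a" and c0: "hermitian_mat n c0" "real_eigenvalues c0 \<epsilon>"
    and \<rho>0: "is_state n \<rho>0" and d: "real_eigenvalues (correlation_matrix n a \<rho>0) d"
    and prot: "gge_protocol n a c0 \<rho>0 N c A \<omega>"
  shows "(\<Sum>k<n. rev (sort d) ! k * sort \<epsilon> ! k) \<le> energy (\<omega> N) (quadratic_hamiltonian n a c0)"
proof -
  let ?x = "\<lambda>k. sort \<epsilon> ! k" and ?y = "\<lambda>k. rev (sort d) ! k"
  have sort_eps: "mset (sort \<epsilon>) = mset \<epsilon>" and sort_d: "mset (rev (sort d)) = mset d" by simp_all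
  note len = hermitian_spectral_real(2)[OF c0 sort_eps]
    hermitian_spectral_real(2)[OF hermitian_correlation[OF a \<rho>0] d sort_d]
  obtain A0 where A0: "unitary_mat n A0" "c0 = A0 * mat_diag n (\<lambda>k. complex_of_real (?x k)) * adj A0"
    using hermitian_spectral_real(1)[OF c0 sort_eps] by blast
  obtain V0 where V0: "unitary_mat n V0"
    "correlation_matrix n a \<rho>0 = V0 * mat_diag n (\<lambda>k. complex_of_real (?y k)) * adj V0"
    using hermitian_spectral_real(1)[OF hermitian_correlation[OF a \<rho>0] d sort_d] by blast
  obtain V D where \<omega>: "is_state n (\<omega> N)" and V: "unitary_mat n V" and D: "doubly_stochastic n D"
    and corr: "correlation_matrix n a (\<omega> N) = V * mat_diag n (\<lambda>i. complex_of_real (\<Sum>j<n. D i j * ?y j)) * adj V"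
    using gge_protocol_correlation[OF a \<rho>0 prot V0 order_refl] by blast
  define G where "G = adj (mat_cnj A0) * V"
  have G: "unitary_mat n G"
    unfolding G_def by (rule unitary_mult[OF unitary_adj[OF unitary_mat_cnj[OF A0(1)]] V])
  define E where "E i j = (\<Sum>k<n. (cmod (G $$ (i, k)))\<^sup>2 * D k j)" for i j
  have E: "doubly_stochastic n E"
    unfolding E_def by (rule doubly_stochastic_mult[OF doubly_stochastic_unitary[OF G] D])
  have "(\<Sum>k<n. (cmod (G $$ (i, k)))\<^sup>2 * (\<Sum>j<n. D k j * ?y j)) = (\<Sum>j<n. E i j * ?y j)" for i
    unfolding E_def sum_distrib_left sum_distrib_right by (subst sum.swap) (simp add: mult_ac)
  then have "energy (\<omega> N) (quadratic_hamiltonian n a c0) = (\<Sum>i<n. \<Sum>j<n. ?x i * E i j * ?y j)"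
    unfolding energy_conj_diag[OF a \<omega> A0 V corr] G_def[symmetric]
    by (simp add: sum_distrib_left mult.assoc)
  moreover have "(\<Sum>k<n. ?x k * ?y k) \<le> (\<Sum>i<n. \<Sum>j<n. ?x i * E i j * ?y j)"
  proof (rule rearrangement_doubly_stochastic[OF E])
    show "?x i \<le> ?x j" if "i \<le> j" "j < n" for i j
      by (rule sorted_nth_mono) (use that len in simp_all)
    show "?y j \<le> ?y i" if "i \<le> j" "j < n" for i j
      by (rule sorted_rev_nth_mono) (use that len in simp_all)
  qed
  ultimately show ?thesis by (simp add: mult.commute)
qed

subsection \<open>Slow rotation of the normal modes\<close>

lemma cos_ge_one_minus: "1 - x\<^sup>2 / 2 \<le> cos (x :: real)"
proof -
  have "\<bar>sin (x / 2)\<bar> \<le> \<bar>x / 2\<bar>" by (rule abs_sin_x_le_abs_x)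
  then have "(sin (x / 2))\<^sup>2 \<le> (x / 2)\<^sup>2" by (rule abs_le_square_iff[THEN iffD1])
  moreover have "cos x = 1 - 2 * (sin (x / 2))\<^sup>2" using cos_double_sin[of "x / 2"] by simp
  ultimately show ?thesis by (simp add: power_divide)
qed

text \<open>The term of order \<open>t\<close> in the diagonal amplitude is purely imaginary, so the probability deviates
  from \<open>1\<close> only to order \<open>t\<^sup>2\<close>.\<close>

lemma diagonal_transition_probability:
  assumes X: "unitary_mat n X" and k: "k < n" and \<theta>: "\<And>i. i < n \<Longrightarrow> \<bar>\<theta> i\<bar> \<le> B"
  shows "1 - (B * t)\<^sup>2 \<le> (cmod ((X * mat_diag n (\<lambda>i. cis (\<theta> i * t)) * adj X) $$ (k, k)))\<^sup>2"
proof -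
  define g where "g = (X * mat_diag n (\<lambda>i. cis (\<theta> i * t)) * adj X) $$ (k, k)"
  have row: "(\<Sum>i<n. (cmod (X $$ (k, i)))\<^sup>2) = 1"
    using doubly_stochastic_unitary[OF X] k by (simp add: doubly_stochastic_def)
  have "g = (\<Sum>i<n. X $$ (k, i) * cis (\<theta> i * t) * cnj (X $$ (k, i)))"
    unfolding g_def by (rule conj_diag_index[OF unitary_carrier[OF X] k k])
  also have "\<dots> = (\<Sum>i<n. complex_of_real ((cmod (X $$ (k, i)))\<^sup>2) * cis (\<theta> i * t))"
    unfolding complex_norm_square by (simp add: mult_ac)
  finally have "Re g = (\<Sum>i<n. (cmod (X $$ (k, i)))\<^sup>2 * cos (\<theta> i * t))"
    by (simp del: of_real_power)
  moreover have "(\<Sum>i<n. (cmod (X $$ (k, i)))\<^sup>2 * (1 - (B * t)\<^sup>2 / 2)) \<le> \<dots>"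
  proof (intro sum_mono mult_left_mono)
    fix i assume "i \<in> {..<n}"
    then have "\<bar>\<theta> i * t\<bar> \<le> \<bar>B * t\<bar>"
      using \<theta>[of i] by (auto simp: abs_mult intro!: mult_right_mono)
    then have "(\<theta> i * t)\<^sup>2 \<le> (B * t)\<^sup>2" by (simp add: abs_le_square_iff)
    then show "1 - (B * t)\<^sup>2 / 2 \<le> cos (\<theta> i * t)"
      using cos_ge_one_minus[of "\<theta> i * t"] by simp
  qed simp
  ultimately have "1 - (B * t)\<^sup>2 / 2 \<le> Re g"
    unfolding sum_distrib_right[symmetric] row by simp
  \<comment> \<open>This says \<open>(Re g)\<^sup>2 \<ge> 2 * Re g - 1\<close>. It doubles the error
    of \<open>Re g\<close> and holds whatever the sign of \<open>Re g\<close>, so that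
    \<open>t\<close> need not be small.\<close>
  moreover have "0 \<le> (Re g - 1)\<^sup>2" by simp
  moreover have "(Re g)\<^sup>2 \<le> (cmod g)\<^sup>2" by (simp add: cmod_power2)
  ultimately show ?thesis unfolding g_def[symmetric] by (simp add: power2_eq_square algebra_simps)
qed

text \<open>Row \<open>k\<close> sums to 1, so the deviation is the weighted sum of x j - x k over
  the other j. Their total weight is 1 - D k k, and each difference is at most 2 C in modulus. The
  second bound keeps \<open>C\<close> valid along iterations.\<close>

lemma doubly_stochastic_near_identity:
  assumes D: "doubly_stochastic n D" and k: "k < n" and x: "\<And>j. j < n \<Longrightarrow> \<bar>x j\<bar> \<le> C"
  shows "\<bar>(\<Sum>j<n. D k j * x j) - x k\<bar> \<le> 2 * C * (1 - D k k)" and "\<bar>\<Sum>j<n. D k j * x j\<bar> \<le> C"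
proof -
  have row: "(\<Sum>j<n. D k j) = 1" and D0: "\<And>j. j < n \<Longrightarrow> 0 \<le> D k j"
    using D k by (simp_all add: doubly_stochastic_def)
  have "(\<Sum>j<n. D k j * x j) - x k = (\<Sum>j<n. D k j * (x j - x k))"
    by (simp add: right_diff_distrib sum_subtractf row flip: sum_distrib_right)
  also have "\<dots> = (\<Sum>j\<in>{..<n} - {k}. D k j * (x j - x k))"
    using k by (subst sum.remove[of _ k]) auto
  also have "\<bar>\<dots>\<bar> \<le> (\<Sum>j\<in>{..<n} - {k}. D k j * (2 * C))"
  proof (rule order_trans[OF sum_abs], rule sum_mono)
    fix j assume "j \<in> {..<n} - {k}"
    then show "\<bar>D k j * (x j - x k)\<bar> \<le> D k j * (2 * C)"
      using D0[of j] x[of j] x[OF k] by (auto simp: abs_mult intro!: mult_left_mono)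
  qed
  also have "\<dots> = 2 * C * (1 - D k k)"
    using k row by (simp add: sum.remove[of _ k] flip: sum_distrib_right)
  finally show "\<bar>(\<Sum>j<n. D k j * x j) - x k\<bar> \<le> 2 * C * (1 - D k k)" .
  have "\<bar>\<Sum>j<n. D k j * x j\<bar> \<le> (\<Sum>j<n. D k j * C)"
    by (rule order_trans[OF sum_abs], rule sum_mono) (use D0 x in \<open>auto simp: abs_mult intro!: mult_left_mono\<close>)
  then show "\<bar>\<Sum>j<n. D k j * x j\<bar> \<le> C" by (simp add: row flip: sum_distrib_right)
qed

text \<open>Each GGE state is only known to exist relative to its predecessor, which calls for
  dependent choice; being a state is carried along, because existence of the next one requires
  it.\<close>

lemma gge_states_exist:
  assumes a: "fermion_ops n a" and A: "\<And>m. unitary_mat n (A m)" and \<rho>0: "is_state n \<rho>0"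
  shows "\<exists>\<omega>. \<omega> 0 = \<rho>0 \<and> (\<forall>m. is_state n (\<omega> m) \<and> gge_state n a (A (Suc m)) (\<omega> m) (\<omega> (Suc m)))"
proof -
  have "\<exists>\<omega>. \<forall>m. (is_state n (\<omega> m) \<and> (m = 0 \<longrightarrow> \<omega> m = \<rho>0)) \<and>
      gge_state n a (A (Suc m)) (\<omega> m) (\<omega> (Suc m))"
  proof (rule dependent_nat_choice)
    show "\<exists>\<rho>. is_state n \<rho> \<and> (0 = (0 :: nat) \<longrightarrow> \<rho> = \<rho>0)" using \<rho>0 by blast
  next
    fix \<rho> and m :: nat assume "is_state n \<rho> \<and> (m = 0 \<longrightarrow> \<rho> = \<rho>0)"
    then obtain \<omega> where "gge_state n a (A (Suc m)) \<rho> \<omega>"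
      using gge_state_exists[OF a A] by blast
    moreover from this have "is_state n \<omega>" unfolding gge_state_def by blast
    ultimately show "\<exists>\<omega>. (is_state n \<omega> \<and> (Suc m = 0 \<longrightarrow> \<omega> = \<rho>0)) \<and> gge_state n a (A (Suc m)) \<rho> \<omega>"
      by blast
  qed
  then show ?thesis by blast
qed

text \<open>The columns of \<open>V\<close> carry the eigenvalues of the initial correlation matrix
  in decreasing order, those of \<open>W0\<close> belong to the energies in increasing order.
  Rotating \<open>V\<close> onto \<open>W0\<close> thus produces the optimal pairing. Convergence
  will follow because \<open>K\<close> does not depend on \<open>M\<close>.\<close>

lemma slow_rotation_protocol:
  assumes a: "fermion_ops n a" and c0: "hermitian_mat n c0" "real_eigenvalues c0 \<epsilon>"
    and \<rho>0: "is_state n \<rho>0" and d: "real_eigenvalues (correlation_matrix n a \<rho>0) d"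
  shows "\<exists>K. \<forall>M\<ge>1. \<exists>c A \<omega>. cyclic_gge_protocol n a c0 \<rho>0 M c A \<omega> \<and>
    \<bar>energy (\<omega> M) (quadratic_hamiltonian n a c0) - (\<Sum>k<n. rev (sort d) ! k * sort \<epsilon> ! k)\<bar> \<le> K / real M"
proof -
  let ?x = "\<lambda>k. sort \<epsilon> ! k" and ?y = "\<lambda>k. rev (sort d) ! k"
  have sort_eps: "mset (sort \<epsilon>) = mset \<epsilon>" and sort_d: "mset (rev (sort d)) = mset d" by simp_all
  obtain A0 where A0: "unitary_mat n A0" "c0 = A0 * mat_diag n (\<lambda>k. complex_of_real (?x k)) * adj A0"
    using hermitian_spectral_real(1)[OF c0 sort_eps] by blast
  obtain V where V: "unitary_mat n V"
    and corr0: "correlation_matrix n a \<rho>0 = V * mat_diag n (\<lambda>k. complex_of_real (?y k)) * adj V"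
    using hermitian_spectral_real(1)[OF hermitian_correlation[OF a \<rho>0] d sort_d] by blast
  define W0 where "W0 = mat_cnj A0"
  have W0: "unitary_mat n W0" unfolding W0_def by (rule unitary_mat_cnj[OF A0(1)])
  \<comment> \<open>\<open>adj V * W0\<close> is the rotation that takes \<open>V\<close> to
    \<open>W0\<close> by multiplication from the right. Its angles generate the group
    \<open>R\<close>, with \<open>R 0\<close> the identity and \<open>V * R 1 = W0\<close>.\<close>
  obtain X \<theta> where X: "unitary_mat n X" and U: "adj V * W0 = X * mat_diag n (\<lambda>i. cis (\<theta> i)) * adj X"
    using unitary_diagonalise[OF unitary_mult[OF unitary_adj[OF V] W0]] by blast
  note Vc = unitary_carrier[OF V] and Xc = unitary_carrier[OF X] and W0c = unitary_carrier[OF W0]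
  define R :: "real \<Rightarrow> complex mat" where "R t = X * mat_diag n (\<lambda>i. cis (\<theta> i * t)) * adj X" for t
  have R: "unitary_mat n (R t)" for t
    unfolding R_def by (intro unitary_mult unitary_adj X unitary_diag) simp
  note Rc = unitary_carrier[OF R]
  have R0: "R 0 = 1\<^sub>m n"
    unfolding R_def by (simp add: right_mult_one_mat[OF Xc] unitary_right[OF X])
  have Radd: "adj (R s) * R t = R (t - s)" for s t :: real
    unfolding R_def adj_conj[OF Xc mat_diag_carrier] adj_diag
    unfolding conj_mult[OF X mat_diag_carrier mat_diag_carrier] mat_diag_diag
    by (simp add: cis_mult cis_cnj algebra_simps)
  have V1: "V * R 1 = W0"
    unfolding R_def using U unitary_cancel(2)[OF V W0c] by simp
  define B where "B = (\<Sum>i<n. \<bar>\<theta> i\<bar>)"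
  have B: "\<bar>\<theta> i\<bar> \<le> B" if "i < n" for i
    unfolding B_def using that by (intro member_le_sum) auto
  define C where "C = (\<Sum>i<n. \<bar>?y i\<bar>)"
  have C: "\<bar>?y i\<bar> \<le> C" if "i < n" for i
    unfolding C_def using that by (intro member_le_sum[where f = "\<lambda>i. \<bar>?y i\<bar>"]) auto
  have C0: "0 \<le> C" unfolding C_def by (intro sum_nonneg) auto
  \<comment> \<open>Each of the M steps changes an occupation by at most
    \<open>2 * C * B\<^sup>2 / M\<^sup>2\<close>, where \<open>B\<close> bounds the rotation angles
    and \<open>C\<close> the occupations. Summing over the steps and weighting with the energies
    gives K / M.\<close>
  define K where "K = (\<Sum>k<n. \<bar>?x k\<bar>) * (2 * C * B\<^sup>2)"
  have "\<exists>c A \<omega>. cyclic_gge_protocol n a c0 \<rho>0 M c A \<omega> \<and>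
    \<bar>energy (\<omega> M) (quadratic_hamiltonian n a c0) - (\<Sum>k<n. ?y k * ?x k)\<bar> \<le> K / real M"
    if M: "1 \<le> M" for M
  proof -
    define W where "W m = V * R (real m / real M)" for m
    have W: "unitary_mat n (W m)" for m unfolding W_def by (rule unitary_mult[OF V R])
    define A where "A m = mat_cnj (W m)" for m
    have A: "unitary_mat n (A m)" for m unfolding A_def by (rule unitary_mat_cnj[OF W])
    have WM: "W M = W0" using M V1 by (simp add: W_def)
    \<comment> \<open>The intermediate Hamiltonians are chosen for their eigenbasis
      \<open>A m\<close>; the eigenvalues 0, ..., n - 1 are distinct, so the normal modes are fixed
      up to phases and order. Taking \<open>c0\<close> at both ends closes the cycle.\<close>
    define c where "c m = (if m = 0 \<or> m = M then c0
      else A m * mat_diag n (\<lambda>k. complex_of_real (real k)) * adj (A m))" for m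
    have c: "hermitian_mat n (c m) \<and> diagonalises n (A m) (c m)" if "m \<in> {1..M}" for m
    proof (cases "m = M")
      case True
      have "A M = A0" unfolding A_def WM W0_def by simp
      then show ?thesis using True c0(1) A0 unfolding diagonalises_def by (auto simp: c_def)
    next
      case False
      then have cm: "c m = A m * mat_diag n (\<lambda>k. complex_of_real (real k)) * adj (A m)"
        using that by (auto simp: c_def)
      have "hermitian_mat n (c m)"
        unfolding hermitian_mat_def cm adj_conj[OF unitary_carrier[OF A] mat_diag_carrier] adj_diag
        using unitary_carrier[OF A] by simp
      then show ?thesis using A cm unfolding diagonalises_def by blast
    qed
    obtain \<omega> where \<omega>0: "\<omega> 0 = \<rho>0" and \<omega>: "\<And>m. is_state n (\<omega> m)"
      and gge: "\<And>m. gge_state n a (A (Suc m)) (\<omega> m) (\<omega> (Suc m))"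
      using gge_states_exist[of n a A, OF a A \<rho>0] by blast
    have "gge_state n a (A m) (\<omega> (m - 1)) (\<omega> m)" if "m \<in> {1..M}" for m
      using gge[of "m - 1"] that by simp
    then have prot: "cyclic_gge_protocol n a c0 \<rho>0 M c A \<omega>"
      unfolding cyclic_gge_protocol_def gge_protocol_def using M c \<omega>0 by (simp add: c_def)
    \<comment> \<open>Negative, because \<open>adj (W (Suc m)) * W m\<close> leads from the later
      basis back to the earlier one. It is independent of \<open>m\<close>, so one matrix
      \<open>D\<close> serves every step.\<close>
    define t where "t = - 1 / real M"
    define D where "D i j = (cmod (R t $$ (i, j)))\<^sup>2" for i j
    have D: "doubly_stochastic n D" unfolding D_def by (rule doubly_stochastic_unitary[OF R])
    have Dkk: "1 - D k k \<le> B\<^sup>2 / (real M)\<^sup>2" if "k < n" for k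
    proof -
      have "1 - (B * t)\<^sup>2 \<le> D k k"
        unfolding D_def R_def by (rule diagonal_transition_probability[OF X that B])
      then show ?thesis by (simp add: t_def power_divide)
    qed
    \<comment> \<open>The occupations after \<open>m\<close> equilibrations: the initial ones under
      the m-fold application of \<open>D\<close>.\<close>
    define p where "p m = ((\<lambda>x k. \<Sum>j<n. D k j * x j) ^^ m) ?y" for m
    have p_Suc: "p (Suc m) = (\<lambda>k. \<Sum>j<n. D k j * p m j)" for m by (simp add: p_def)
    have step: "adj (W (Suc m)) * W m = R t" for m
    proof -
      have "adj (W (Suc m)) * W m = adj (R (real (Suc m) / real M)) * R (real m / real M)"
        unfolding W_def adj_mult[OF Vc Rc] sq_assoc[OF adj_carrier[OF Rc] adj_carrier[OF Vc] sq_mult_carrier[OF Vc Rc]]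
          unitary_cancel(1)[OF V Rc] ..
      also have "\<dots> = R t" unfolding Radd t_def by (simp add: add_divide_distrib diff_divide_distrib[symmetric])
      finally show ?thesis .
    qed
    have corr: "correlation_matrix n a (\<omega> m) = W m * mat_diag n (\<lambda>i. complex_of_real (p m i)) * adj (W m)" for m
    proof (induction m)
      case 0
      have "W 0 = V" by (simp add: W_def R0 right_mult_one_mat[OF Vc])
      then show ?case using corr0 \<omega>0 by (simp add: p_def)
    next
      case (Suc m)
      have AW: "mat_cnj (A (Suc m)) = W (Suc m)" by (simp add: A_def)
      show ?case
        using gge_state_correlation[OF a A gge \<omega> W Suc.IH]
        unfolding AW step p_Suc D_def .
    qed
    have pC: "\<bar>p m k\<bar> \<le> C" if "k < n" for m k
      using that by (induction m arbitrary: k)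
        (simp add: p_def C, simp add: p_Suc doubly_stochastic_near_identity(2)[OF D])
    define e where "e = 2 * C * (B\<^sup>2 / (real M)\<^sup>2)"
    have dev: "\<bar>p m k - ?y k\<bar> \<le> real m * e" if k: "k < n" for m k
    proof (induction m)
      case (Suc m)
      have "\<bar>p (Suc m) k - p m k\<bar> \<le> 2 * C * (1 - D k k)"
        unfolding p_Suc by (rule doubly_stochastic_near_identity(1)[OF D k pC])
      also have "\<dots> \<le> e"
        unfolding e_def using Dkk[OF k] C0 by (intro mult_left_mono) auto
      finally show ?case using Suc.IH unfolding of_nat_Suc distrib_right mult_1 by linarith
    qed (simp add: p_def)
    have devM: "\<bar>p M k - ?y k\<bar> \<le> 2 * C * B\<^sup>2 / real M" if k: "k < n" for k
      using dev[OF k, of M] M by (simp add: e_def power2_eq_square field_simps)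
    \<comment> \<open>The last rotated basis is the eigenbasis of \<open>c0\<close>, so the final
      energy is read off without a further transition matrix.\<close>
    have one: "adj (mat_cnj A0) * W M = 1\<^sub>m n"
      unfolding WM W0_def[symmetric] by (rule unitary_left[OF W0])
    have "energy (\<omega> M) (quadratic_hamiltonian n a c0) = (\<Sum>k<n. ?x k * p M k)"
      unfolding energy_conj_diag[OF a \<omega> A0 W corr] one
      by (intro sum.cong refl arg_cong2[where f = times])
        (auto simp: if_distrib[of "\<lambda>x. (cmod x)\<^sup>2 * _"] cong: if_cong)
    then have "\<bar>energy (\<omega> M) (quadratic_hamiltonian n a c0) - (\<Sum>k<n. ?y k * ?x k)\<bar> =
        \<bar>\<Sum>k<n. ?x k * (p M k - ?y k)\<bar>"
      by (simp add: sum_subtractf right_diff_distrib mult.commute)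
    also have "\<dots> \<le> (\<Sum>k<n. \<bar>?x k\<bar> * (2 * C * B\<^sup>2 / real M))"
      unfolding abs_mult[symmetric]
    proof (rule order_trans[OF sum_abs], rule sum_mono)
      fix k assume "k \<in> {..<n}"
      then show "\<bar>?x k * (p M k - ?y k)\<bar> \<le> \<bar>?x k\<bar> * (2 * C * B\<^sup>2 / real M)"
        unfolding abs_mult by (intro mult_left_mono devM) simp_all
    qed
    also have "\<dots> = K / real M" by (simp add: K_def sum_distrib_right sum_divide_distrib)
    finally show ?thesis using prot by blast
  qed
  then show ?thesis by blast
qed

theorem mainTheorem8:
  fixes n :: nat
    and a :: "nat \<Rightarrow> complex mat"
    and c0 \<rho>0 :: "complex mat"
    and \<epsilon> d :: "real list"
  assumes "fermion_ops n a"
    and "hermitian_mat n c0"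
    and "real_eigenvalues c0 \<epsilon>"
    and "is_state n \<rho>0"
    and "real_eigenvalues (correlation_matrix n a \<rho>0) d"
  shows "(\<forall>N c A \<omega>. cyclic_gge_protocol n a c0 \<rho>0 N c A \<omega> \<longrightarrow>
             energy (\<omega> N) (quadratic_hamiltonian n a c0) \<ge> (\<Sum>k<n. rev (sort d) ! k * sort \<epsilon> ! k)) \<and>
         (\<exists>(N :: nat \<Rightarrow> nat) c A \<omega>.
             (\<forall>s. cyclic_gge_protocol n a c0 \<rho>0 (N s) (c s) (A s) (\<omega> s)) \<and>
             filterlim N at_top sequentially \<and>
             (\<lambda>s. energy (\<omega> s (N s)) (quadratic_hamiltonian n a c0))
               \<longlonglongrightarrow> (\<Sum>k<n. rev (sort d) ! k * sort \<epsilon> ! k))"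
proof
  show "\<forall>N c A \<omega>. cyclic_gge_protocol n a c0 \<rho>0 N c A \<omega> \<longrightarrow>
      energy (\<omega> N) (quadratic_hamiltonian n a c0) \<ge> (\<Sum>k<n. rev (sort d) ! k * sort \<epsilon> ! k)"
  proof (intro allI impI)
    fix N c A \<omega> assume "cyclic_gge_protocol n a c0 \<rho>0 N c A \<omega>"
    then have "gge_protocol n a c0 \<rho>0 N c A \<omega>" unfolding cyclic_gge_protocol_def by blast
    then show "energy (\<omega> N) (quadratic_hamiltonian n a c0) \<ge> (\<Sum>k<n. rev (sort d) ! k * sort \<epsilon> ! k)"
      by (rule gge_protocol_energy_bound[OF assms])
  qed
  let ?R = "\<Sum>k<n. rev (sort d) ! k * sort \<epsilon> ! k"
  obtain K where K: "\<forall>M\<ge>1. \<exists>c A \<omega>. cyclic_gge_protocol n a c0 \<rho>0 M c A \<omega> \<and>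
      \<bar>energy (\<omega> M) (quadratic_hamiltonian n a c0) - ?R\<bar> \<le> K / real M"
    using slow_rotation_protocol[OF assms] by blast
  \<comment> \<open>\<open>Suc s\<close> quenches, because a cyclic protocol contains at least one
    and the bound K / M requires M \<ge> 1.\<close>
  have "\<forall>s. \<exists>c A \<omega>. cyclic_gge_protocol n a c0 \<rho>0 (Suc s) c A \<omega> \<and>
      \<bar>energy (\<omega> (Suc s)) (quadratic_hamiltonian n a c0) - ?R\<bar> \<le> K / real (Suc s)"
    by (rule allI, rule K[rule_format]) simp
  from choice[OF this] obtain c where "\<forall>s. \<exists>A \<omega>. cyclic_gge_protocol n a c0 \<rho>0 (Suc s) (c s) A \<omega> \<and>
      \<bar>energy (\<omega> (Suc s)) (quadratic_hamiltonian n a c0) - ?R\<bar> \<le> K / real (Suc s)" ..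
  from choice[OF this] obtain A where "\<forall>s. \<exists>\<omega>. cyclic_gge_protocol n a c0 \<rho>0 (Suc s) (c s) (A s) \<omega> \<and>
      \<bar>energy (\<omega> (Suc s)) (quadratic_hamiltonian n a c0) - ?R\<bar> \<le> K / real (Suc s)" ..
  from choice[OF this] obtain \<omega> where "\<forall>s. cyclic_gge_protocol n a c0 \<rho>0 (Suc s) (c s) (A s) (\<omega> s) \<and>
      \<bar>energy (\<omega> s (Suc s)) (quadratic_hamiltonian n a c0) - ?R\<bar> \<le> K / real (Suc s)" ..
  then have prot: "\<And>s. cyclic_gge_protocol n a c0 \<rho>0 (Suc s) (c s) (A s) (\<omega> s)"
    and dev: "\<And>s. \<bar>energy (\<omega> s (Suc s)) (quadratic_hamiltonian n a c0) - ?R\<bar> \<le> K / real (Suc s)"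
    by blast+
  have lim: "(\<lambda>s. K / real (Suc s)) \<longlonglongrightarrow> 0"
    using tendsto_mult_right_zero[OF LIMSEQ_inverse_real_of_nat, of K] by (simp add: divide_inverse)
  have "(\<lambda>s. \<bar>energy (\<omega> s (Suc s)) (quadratic_hamiltonian n a c0) - ?R\<bar>) \<longlonglongrightarrow> 0"
    by (rule tendsto_sandwich[OF _ _ tendsto_const lim]) (use dev in \<open>simp_all add: always_eventually\<close>)
  then have "(\<lambda>s. energy (\<omega> s (Suc s)) (quadratic_hamiltonian n a c0) - ?R) \<longlonglongrightarrow> 0"
    by (rule tendsto_rabs_zero_cancel)
  then have "(\<lambda>s. energy (\<omega> s (Suc s)) (quadratic_hamiltonian n a c0)) \<longlonglongrightarrow> ?R"
    by (simp add: LIM_zero_iff)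
  with prot show "\<exists>(N :: nat \<Rightarrow> nat) c A \<omega>.
      (\<forall>s. cyclic_gge_protocol n a c0 \<rho>0 (N s) (c s) (A s) (\<omega> s)) \<and>
      filterlim N at_top sequentially \<and>
      (\<lambda>s. energy (\<omega> s (N s)) (quadratic_hamiltonian n a c0)) \<longlonglongrightarrow> ?R"
    by (intro exI[of _ Suc] exI[of _ c] exI[of _ A] exI[of _ \<omega>]) (simp add: filterlim_Suc)
qed

end
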